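(* Every pre-symplectic left-symmetric algebra over $\mathbb{K}$ is either a Milnor pre-symplectic algebra or can be obtained by a finite sequence of double extensions by commutative associative algebras starting from a Milnor pre-symplectic algebra. That is, if it is not a Milnor pre-symplectic algebra, there exist $n\ge1$ and pre-symplectic left-symmetric algebras $\mathcal{A}_0,\dots,\mathcal{A}_n$ such that $\mathcal{A}_0$ is a Milnor pre-symplectic algebra, each $\mathcal{A}_k$ ($1\le k\le n$) is a double extension of $\mathcal{A}_{k-1}$ by some nonzero commutative associative algebra $\mathfrak{h}_k$, and $\mathcal{A}_n$ is the given algebra.
   Context: $\mathbb{K}$ is a field of characteristic $0$; all vector spaces are finite-dimensional. $[u,v]_\bullet=u\bullet v-v\bullet u$. A pre-symplectic left-symmetric algebra is a triple $(\mathcal{A},\bullet,\omega)$ where $(u\bullet v)\bullet w-u\bullet(v\bullet w)=(v\bullet u)\bullet w-v\bullet(u\bullet w)$ and $\omega$ is a nondegenerate skew-symmetric bilinear form with $\omega(u\bullet v,w)=\omega(v,u\bullet w)$ for all $u,v,w$. The zero-dimensional algebra is allowed. A Milnor pre-symplectic algebra is an algebra $(\mathcal{A},\bullet)$ with a nondegenerate skew-symmetric bilinear form $\omega$ such that $\omega(u\bullet v,w)=\omega(v,u\bullet w)$ for all $u,v,w$, $[\cdot,\cdot]_\bullet$ is a Lie bracket, and there is a two-sided ideal $I$, nondegenerate ($I\cap I^\perp=\{0\}$, where $I^\perp$ is the $\omega$-orthogonal), with $\mathcal{A}\bullet\mathcal{A}\subset I$ and $u\bullet v=0$ for all $u\in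 I$, $v\in\mathcal{A}$. The zero algebra is Milnor. Double extension: let $(\mathcal{B},\bullet_{\mathcal{B}},\omega_{\mathcal{B}})$ be a pre-symplectic left-symmetric algebra and $(\mathfrak{h},\circ)$ a commutative associative algebra. The data are linear maps $F,G:\mathfrak{h}\to\mathrm{End}(\mathcal{B})$ with all $F(a)$ symmetric w.r.t. $\omega_{\mathcal{B}}$, bilinear maps $\theta,\Omega:\mathfrak{h}\times\mathfrak{h}\to\mathcal{B}$ with $\Omega$ skew-symmetric, and a bilinear $L:\mathfrak{h}\times\mathfrak{h}\to\mathfrak{h}^*$ with $L(a,b)(c)=-L(a,c)(b)$, such that for all $a,b,c,l\in\mathfrak{h}$, $u,v\in\mathcal{B}$ (writing $\bullet$ for $\bullet_{\mathcal{B}}$ and $T^*$ for the adjoint, $\omega_{\mathcal{B}}(Tx,y)=\omega_{\mathcal{B}}(x,T^*y)$): (A) $G(a)([u,v]_\bullet)=0$; $u\bullet G(a)v=v\bullet G(a)u$; $G(a)(u)\bullet v=F(a)(u)\bullet v$; $F(a)(u\bullet v)=u\bullet F(a)(v)$; $G(b)G(a)=G(b)F(a)$; $F(a)F(b)=F(b)F(a)$; $F(a)G(b)u=G(a\circ b)u+u\bullet\theta(a,b)$; $\theta(a,b)\bullet u=\theta(b,a)\bullet u$; $G(c)\theta(a,b)=G(c)\theta(b,a)$; $\theta(a,b\circ c)-\theta(b,a\circ c)=F(b)\theta(a,c)-F(a)\theta(b,c)$; (B) $G(a)^*G(b)=-G(b)^*G(a)$; $G(a)^*\Omega(b,c)=F(a)\Omega(b,c)$;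 $G(b)^*\theta(a,c)+\Omega(a\circ c,b)=-G(c)^*\theta(a,b)-\Omega(a\circ b,c)$; $L(a,b\circ c)(l)-L(b,a\circ c)(l)=-L(a,b\circ l)(c)+L(b,a\circ l)(c)$; $\omega_{\mathcal{B}}(\Omega(a,b),[u,v]_\bullet)=0$; $\omega_{\mathcal{B}}(\Omega(c,l),\theta(a,b)-\theta(b,a))=0$. The double extension of $\mathcal{B}$ by $\mathfrak{h}$ by means of $(F,G,\theta,L,\Omega)$ is $\mathfrak{h}\oplus\mathcal{B}\oplus\mathfrak{h}^*$ with product $u\bullet v=u\bullet_{\mathcal{B}}v-\omega_{\mathcal{B}}(G(\cdot)u,v)$, $u\bullet a=G(a)u+\omega_{\mathcal{B}}(\Omega(a,\cdot),u)$, $a\bullet u=F(a)u-\omega_{\mathcal{B}}(\theta(a,\cdot),u)$, $a\bullet b=a\circ b+\theta(a,b)+L(a,b)$, $a\bullet f=(b\mapsto f(a\circ b))$, all other products zero ($a,b\in\mathfrak{h}$, $u,v\in\mathcal{B}$, $f\in\mathfrak{h}^*$; a dot marks the argument of an element of $\mathfrak{h}^*$), and form $\omega(u+a+f,v+b+g)=\omega_{\mathcal{B}}(u,v)+f(b)-g(a)$. An algebra "is a double extension" if it is isomorphic, by an algebra isomorphism preserving the forms, to one of these. *)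

theory Defs
  imports Complex_Main "HOL-Library.Function_Algebras" "HOL-Library.Product_Plus"
begin

text \<open>
  All vector spaces are finite-dimensional subspaces of an ambient vector space given by a type
  together with a scalar multiplication \<open>scale\<close>, in the style of \<^locale>\<open>vector_space\<close>. The ambient
  space itself may be infinite-dimensional. Operations are total functions of which only the
  restriction to the carriers is relevant; all conditions are relativised accordingly.
\<close>

subsection \<open>Linear algebra on carriers\<close>

definition fin_dim_subspace :: "('k::field \<Rightarrow> 'v::ab_group_add \<Rightarrow> 'v) \<Rightarrow> 'v set \<Rightarrow> bool" where
  "fin_dim_subspace scale V \<longleftrightarrow> (\<exists>X. finite X \<and> V = module.span scale X)"

definition linear_on ::
  "('k::field \<Rightarrow> 'v::ab_group_add \<Rightarrow> 'v) \<Rightarrow> ('k \<Rightarrow> 'w::ab_group_add \<Rightarrow> 'w) \<Rightarrow>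
   'v set \<Rightarrow> 'w set \<Rightarrow> ('v \<Rightarrow> 'w) \<Rightarrow> bool" where
  "linear_on s1 s2 V W f \<longleftrightarrow>
     (\<forall>x\<in>V. f x \<in> W) \<and>
     (\<forall>x\<in>V. \<forall>y\<in>V. f (x + y) = f x + f y) \<and>
     (\<forall>c. \<forall>x\<in>V. f (s1 c x) = s2 c (f x))"

definition bilinear_on ::
  "('k::field \<Rightarrow> 'u::ab_group_add \<Rightarrow> 'u) \<Rightarrow> ('k \<Rightarrow> 'v::ab_group_add \<Rightarrow> 'v) \<Rightarrow>
   ('k \<Rightarrow> 'w::ab_group_add \<Rightarrow> 'w) \<Rightarrow> 'u set \<Rightarrow> 'v set \<Rightarrow> 'w set \<Rightarrow> ('u \<Rightarrow> 'v \<Rightarrow> 'w) \<Rightarrow> bool" where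
  "bilinear_on s1 s2 s3 U V W f \<longleftrightarrow>
     (\<forall>x\<in>U. linear_on s2 s3 V W (f x)) \<and>
     (\<forall>y\<in>V. linear_on s1 s3 U W (\<lambda>x. f x y))"

definition fun_scale :: "'k::field \<Rightarrow> ('v \<Rightarrow> 'k) \<Rightarrow> 'v \<Rightarrow> 'k" where
  "fun_scale c f = (\<lambda>x. c * f x)"

text \<open>
  A linear functional on \<open>V\<close> is represented by its extension by zero outside \<open>V\<close>, so that
  functionals on \<open>V\<close> correspond to unique elements of \<open>dual_space scale V\<close>.
\<close>

definition dual_space :: "('k::field \<Rightarrow> 'v::ab_group_add \<Rightarrow> 'v) \<Rightarrow> 'v set \<Rightarrow> ('v \<Rightarrow> 'k) set" where
  "dual_space scale V = {f. linear_on scale (*) V UNIV f \<and> (\<forall>x. x \<notin> V \<longrightarrow> f x = 0)}"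

definition nondeg_skew_form ::
  "('k::field \<Rightarrow> 'v::ab_group_add \<Rightarrow> 'v) \<Rightarrow> 'v set \<Rightarrow> ('v \<Rightarrow> 'v \<Rightarrow> 'k) \<Rightarrow> bool" where
  "nondeg_skew_form scale V \<omega> \<longleftrightarrow>
     bilinear_on scale scale (*) V V UNIV \<omega> \<and>
     (\<forall>u\<in>V. \<forall>v\<in>V. \<omega> u v = - \<omega> v u) \<and>
     (\<forall>u\<in>V. (\<forall>v\<in>V. \<omega> u v = 0) \<longrightarrow> u = 0)"

definition orthogonal_on :: "'v set \<Rightarrow> ('v \<Rightarrow> 'v \<Rightarrow> 'k::zero) \<Rightarrow> 'v set \<Rightarrow> 'v set" where
  "orthogonal_on V \<omega> I = {u\<in>V. \<forall>v\<in>I. \<omega> u v = 0}"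

text \<open>
  The adjoint is well defined on \<open>V\<close> for \<open>T\<close> linear, \<open>V\<close> finite-dimensional and \<open>\<omega>\<close> nondegenerate.
\<close>

definition adjoint_on :: "'v set \<Rightarrow> ('v \<Rightarrow> 'v \<Rightarrow> 'k) \<Rightarrow> ('v \<Rightarrow> 'v) \<Rightarrow> 'v \<Rightarrow> 'v" where
  "adjoint_on V \<omega> T y = (THE z. z \<in> V \<and> (\<forall>x\<in>V. \<omega> (T x) y = \<omega> x z))"

subsection \<open>Algebras\<close>

record 'v alg =
  carrier :: "'v set"
  mul :: "'v \<Rightarrow> 'v \<Rightarrow> 'v"

record ('v, 'k) form_alg = "'v alg" +
  form :: "'v \<Rightarrow> 'v \<Rightarrow> 'k"

definition bracket :: "('v::ab_group_add, 'm) alg_scheme \<Rightarrow> 'v \<Rightarrow> 'v \<Rightarrow> 'v" where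
  "bracket A u v = mul A u v - mul A v u"

definition is_alg :: "('k::field \<Rightarrow> 'v::ab_group_add \<Rightarrow> 'v) \<Rightarrow> ('v, 'm) alg_scheme \<Rightarrow> bool" where
  "is_alg scale A \<longleftrightarrow>
     fin_dim_subspace scale (carrier A) \<and>
     bilinear_on scale scale scale (carrier A) (carrier A) (carrier A) (mul A)"

definition comm_assoc_alg ::
  "('k::field \<Rightarrow> 'v::ab_group_add \<Rightarrow> 'v) \<Rightarrow> ('v, 'm) alg_scheme \<Rightarrow> bool" where
  "comm_assoc_alg scale A \<longleftrightarrow>
     is_alg scale A \<and>
     (\<forall>a\<in>carrier A. \<forall>b\<in>carrier A. mul A a b = mul A b a) \<and>
     (\<forall>a\<in>carrier A. \<forall>b\<in>carrier A. \<forall>c\<in>carrier A. mul A (mul A a b) c = mul A a (mul A b c))"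

definition left_symmetric_alg ::
  "('k::field \<Rightarrow> 'v::ab_group_add \<Rightarrow> 'v) \<Rightarrow> ('v, 'm) alg_scheme \<Rightarrow> bool" where
  "left_symmetric_alg scale A \<longleftrightarrow>
     is_alg scale A \<and>
     (\<forall>u\<in>carrier A. \<forall>v\<in>carrier A. \<forall>w\<in>carrier A.
        mul A (mul A u v) w - mul A u (mul A v w) = mul A (mul A v u) w - mul A v (mul A u w))"

definition left_mul_symmetric :: "('v, 'k) form_alg \<Rightarrow> bool" where
  "left_mul_symmetric A \<longleftrightarrow>
     (\<forall>u\<in>carrier A. \<forall>v\<in>carrier A. \<forall>w\<in>carrier A. form A (mul A u v) w = form A v (mul A u w))"

definition pre_symplectic_lsa ::
  "('k::field \<Rightarrow> 'v::ab_group_add \<Rightarrow> 'v) \<Rightarrow> ('v, 'k) form_alg \<Rightarrow> bool" where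
  "pre_symplectic_lsa scale A \<longleftrightarrow>
     left_symmetric_alg scale A \<and>
     nondeg_skew_form scale (carrier A) (form A) \<and>
     left_mul_symmetric A"

definition lie_bracket_on ::
  "('k::field \<Rightarrow> 'v::ab_group_add \<Rightarrow> 'v) \<Rightarrow> 'v set \<Rightarrow> ('v \<Rightarrow> 'v \<Rightarrow> 'v) \<Rightarrow> bool" where
  "lie_bracket_on scale V br \<longleftrightarrow>
     bilinear_on scale scale scale V V V br \<and>
     (\<forall>u\<in>V. br u u = 0) \<and>
     (\<forall>u\<in>V. \<forall>v\<in>V. \<forall>w\<in>V. br u (br v w) + br v (br w u) + br w (br u v) = 0)"

definition two_sided_ideal ::
  "('k::field \<Rightarrow> 'v::ab_group_add \<Rightarrow> 'v) \<Rightarrow> ('v, 'm) alg_scheme \<Rightarrow> 'v set \<Rightarrow> bool" where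
  "two_sided_ideal scale A I \<longleftrightarrow>
     module.subspace scale I \<and> I \<subseteq> carrier A \<and>
     (\<forall>u\<in>carrier A. \<forall>x\<in>I. mul A u x \<in> I \<and> mul A x u \<in> I)"

definition milnor_pre_symplectic ::
  "('k::field \<Rightarrow> 'v::ab_group_add \<Rightarrow> 'v) \<Rightarrow> ('v, 'k) form_alg \<Rightarrow> bool" where
  "milnor_pre_symplectic scale A \<longleftrightarrow>
     is_alg scale A \<and>
     nondeg_skew_form scale (carrier A) (form A) \<and>
     left_mul_symmetric A \<and>
     lie_bracket_on scale (carrier A) (bracket A) \<and>
     (\<exists>I. two_sided_ideal scale A I \<and>
          I \<inter> orthogonal_on (carrier A) (form A) I = {0} \<and>
          (\<forall>u\<in>carrier A. \<forall>v\<in>carrier A. mul A u v \<in> I) \<and>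
          (\<forall>u\<in>I. \<forall>v\<in>carrier A. mul A u v = 0))"

text \<open>Isomorphisms may relate algebras living in different ambient spaces.\<close>

definition form_alg_iso ::
  "('k::field \<Rightarrow> 'v::ab_group_add \<Rightarrow> 'v) \<Rightarrow> ('k \<Rightarrow> 'w::ab_group_add \<Rightarrow> 'w) \<Rightarrow>
   ('v, 'k) form_alg \<Rightarrow> ('w, 'k) form_alg \<Rightarrow> bool" where
  "form_alg_iso s1 s2 A D \<longleftrightarrow>
     (\<exists>\<phi>. linear_on s1 s2 (carrier A) (carrier D) \<phi> \<and>
          bij_betw \<phi> (carrier A) (carrier D) \<and>
          (\<forall>u\<in>carrier A. \<forall>v\<in>carrier A. \<phi> (mul A u v) = mul D (\<phi> u) (\<phi> v)) \<and>
          (\<forall>u\<in>carrier A. \<forall>v\<in>carrier A. form D (\<phi> u) (\<phi> v) = form A u v))"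

subsection \<open>Double extensions\<close>

text \<open>
  \<open>F a\<close> and \<open>G a\<close> are endomorphisms of \<open>B\<close>; \<open>L a b\<close> is a functional on \<open>h\<close>.
\<close>

locale double_extension_data =
  fixes scale :: "'k::field \<Rightarrow> 'v::ab_group_add \<Rightarrow> 'v"
    and B :: "('v, 'k) form_alg"
    and h :: "'v alg"
    and F G :: "'v \<Rightarrow> 'v \<Rightarrow> 'v"
    and \<theta> :: "'v \<Rightarrow> 'v \<Rightarrow> 'v"
    and L :: "'v \<Rightarrow> 'v \<Rightarrow> 'v \<Rightarrow> 'k"
    and \<Omega> :: "'v \<Rightarrow> 'v \<Rightarrow> 'v"
    and mulB (infixl "\<bullet>" 70) and mulh (infixl "\<odot>" 70) and \<omega> and V and H and adj
  defines "u \<bullet> v \<equiv> mul B u v"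
    and "a \<odot> b \<equiv> mul h a b"
    and "\<omega> \<equiv> form B"
    and "V \<equiv> carrier B"
    and "H \<equiv> carrier h"
    and "adj \<equiv> adjoint_on V \<omega>"
  assumes B: "pre_symplectic_lsa scale B"
    and h: "comm_assoc_alg scale h"
    and F_linear: "bilinear_on scale scale scale H V V F"
    and G_linear: "bilinear_on scale scale scale H V V G"
    and F_symmetric: "\<And>a u v. \<lbrakk>a \<in> H; u \<in> V; v \<in> V\<rbrakk> \<Longrightarrow> \<omega> (F a u) v = \<omega> u (F a v)"
    and theta_bilinear: "bilinear_on scale scale scale H H V \<theta>"
    and Omega_bilinear: "bilinear_on scale scale scale H H V \<Omega>"
    and Omega_skew: "\<And>a b. \<lbrakk>a \<in> H; b \<in> H\<rbrakk> \<Longrightarrow> \<Omega> a b = - \<Omega> b a"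
    and L_bilinear: "bilinear_on scale scale fun_scale H H (dual_space scale H) L"
    and L_skew: "\<And>a b c. \<lbrakk>a \<in> H; b \<in> H; c \<in> H\<rbrakk> \<Longrightarrow> L a b c = - L a c b"
    and A_1: "\<And>a u v. \<lbrakk>a \<in> H; u \<in> V; v \<in> V\<rbrakk> \<Longrightarrow> G a (bracket B u v) = 0"
    and A_2: "\<And>a u v. \<lbrakk>a \<in> H; u \<in> V; v \<in> V\<rbrakk> \<Longrightarrow> u \<bullet> G a v = v \<bullet> G a u"
    and A_3: "\<And>a u v. \<lbrakk>a \<in> H; u \<in> V; v \<in> V\<rbrakk> \<Longrightarrow> G a u \<bullet> v = F a u \<bullet> v"
    and A_4: "\<And>a u v. \<lbrakk>a \<in> H; u \<in> V; v \<in> V\<rbrakk> \<Longrightarrow> F a (u \<bullet> v) = u \<bullet> F a v"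
    and A_5: "\<And>a b u. \<lbrakk>a \<in> H; b \<in> H; u \<in> V\<rbrakk> \<Longrightarrow> G b (G a u) = G b (F a u)"
    and A_6: "\<And>a b u. \<lbrakk>a \<in> H; b \<in> H; u \<in> V\<rbrakk> \<Longrightarrow> F a (F b u) = F b (F a u)"
    and A_7: "\<And>a b u. \<lbrakk>a \<in> H; b \<in> H; u \<in> V\<rbrakk> \<Longrightarrow> F a (G b u) = G (a \<odot> b) u + u \<bullet> \<theta> a b"
    and A_8: "\<And>a b u. \<lbrakk>a \<in> H; b \<in> H; u \<in> V\<rbrakk> \<Longrightarrow> \<theta> a b \<bullet> u = \<theta> b a \<bullet> u"
    and A_9: "\<And>a b c. \<lbrakk>a \<in> H; b \<in> H; c \<in> H\<rbrakk> \<Longrightarrow> G c (\<theta> a b) = G c (\<theta> b a)"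
    and A_10: "\<And>a b c. \<lbrakk>a \<in> H; b \<in> H; c \<in> H\<rbrakk> \<Longrightarrow>
          \<theta> a (b \<odot> c) - \<theta> b (a \<odot> c) = F b (\<theta> a c) - F a (\<theta> b c)"
    and B_1: "\<And>a b u. \<lbrakk>a \<in> H; b \<in> H; u \<in> V\<rbrakk> \<Longrightarrow> adj (G a) (G b u) = - adj (G b) (G a u)"
    and B_2: "\<And>a b c. \<lbrakk>a \<in> H; b \<in> H; c \<in> H\<rbrakk> \<Longrightarrow> adj (G a) (\<Omega> b c) = F a (\<Omega> b c)"
    and B_3: "\<And>a b c. \<lbrakk>a \<in> H; b \<in> H; c \<in> H\<rbrakk> \<Longrightarrow>
          adj (G b) (\<theta> a c) + \<Omega> (a \<odot> c) b = - adj (G c) (\<theta> a b) - \<Omega> (a \<odot> b) c"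
    and B_4: "\<And>a b c l. \<lbrakk>a \<in> H; b \<in> H; c \<in> H; l \<in> H\<rbrakk> \<Longrightarrow>
          L a (b \<odot> c) l - L b (a \<odot> c) l = - L a (b \<odot> l) c + L b (a \<odot> l) c"
    and B_5: "\<And>a b u v. \<lbrakk>a \<in> H; b \<in> H; u \<in> V; v \<in> V\<rbrakk> \<Longrightarrow> \<omega> (\<Omega> a b) (bracket B u v) = 0"
    and B_6: "\<And>a b c l. \<lbrakk>a \<in> H; b \<in> H; c \<in> H; l \<in> H\<rbrakk> \<Longrightarrow>
          \<omega> (\<Omega> c l) (\<theta> a b - \<theta> b a) = 0"

text \<open>
  The triple \<open>(a, u, f)\<close> stands for \<open>a + u + f\<close> in \<open>h \<oplus> B \<oplus> h\<^sup>*\<close>; the product below is the bilinear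
  extension of the products of homogeneous elements.
\<close>

type_synonym ('v, 'k) dext = "'v \<times> 'v \<times> ('v \<Rightarrow> 'k)"

definition dext_scale ::
  "('k::field \<Rightarrow> 'v \<Rightarrow> 'v) \<Rightarrow> 'k \<Rightarrow> ('v, 'k) dext \<Rightarrow> ('v, 'k) dext" where
  "dext_scale scale c = (\<lambda>(a, u, f). (scale c a, scale c u, fun_scale c f))"

definition double_extension ::
  "('k::field \<Rightarrow> 'v::ab_group_add \<Rightarrow> 'v) \<Rightarrow> ('v, 'k) form_alg \<Rightarrow> 'v alg \<Rightarrow>
   ('v \<Rightarrow> 'v \<Rightarrow> 'v) \<Rightarrow> ('v \<Rightarrow> 'v \<Rightarrow> 'v) \<Rightarrow> ('v \<Rightarrow> 'v \<Rightarrow> 'v) \<Rightarrow> ('v \<Rightarrow> 'v \<Rightarrow> 'v \<Rightarrow> 'k) \<Rightarrow>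
   ('v \<Rightarrow> 'v \<Rightarrow> 'v) \<Rightarrow> (('v, 'k) dext, 'k) form_alg" where
  "double_extension scale B h F G \<theta> L \<Omega> =
     \<lparr> carrier = carrier h \<times> carrier B \<times> dual_space scale (carrier h),
       mul = (\<lambda>(a, u, f) (b, v, g).
         (mul h a b,
          mul B u v + G b u + F a v + \<theta> a b,
          (\<lambda>c. if c \<in> carrier h
               then - form B (G c u) v + form B (\<Omega> b c) u - form B (\<theta> a c) v
                    + L a b c + g (mul h a c)
               else 0))),
       form = (\<lambda>(a, u, f) (b, v, g). form B u v + f b - g a) \<rparr>"

definition is_double_extension ::
  "('k::field \<Rightarrow> 'v::ab_group_add \<Rightarrow> 'v) \<Rightarrow> ('v, 'k) form_alg \<Rightarrow> ('v, 'k) form_alg \<Rightarrow> 'v alg \<Rightarrow> bool"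
where
  "is_double_extension scale A B h \<longleftrightarrow>
     (\<exists>F G \<theta> L \<Omega>. double_extension_data scale B h F G \<theta> L \<Omega> \<and>
        form_alg_iso scale (dext_scale scale) A (double_extension scale B h F G \<theta> L \<Omega>))"

end

theory Submission
  imports Defs
begin

text \<open>
  Let \<open>L\<^sub>u\<close> be left multiplication by \<open>u\<close>. Left symmetry reads \<open>L\<^bsub>[u,v]\<^esub> = L\<^sub>u L\<^sub>v - L\<^sub>v L\<^sub>u\<close>; as
  every \<open>L\<^sub>u\<close> is self-adjoint for \<open>\<omega>\<close>, one side is self-adjoint and the other anti-self-adjoint, so
  left multiplications commute and brackets act by zero (\<open>left_mul_commute\<close>,
  \<open>prod_commute_left_factor\<close>). Hence \<open>K = {x. L\<^sub>x = 0}\<close> is a two-sided ideal containing all brackets,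
  and \<open>K\<^sup>\<bottom>\<close> is a left ideal.

  If \<open>K \<inter> K\<^sup>\<bottom> = {0}\<close>, products in \<open>K\<^sup>\<bottom>\<close> vanish, so all products lie in \<open>K\<close> and the algebra is
  Milnor with ideal \<open>K\<close> (\<open>milnor_if_left_kernel_nondegenerate\<close>).

  Otherwise take a minimal nonzero subspace \<open>I\<close> of \<open>K \<inter> K\<^sup>\<bottom>\<close> stable under all \<open>L\<^sub>u\<close>. It is
  isotropic, \<open>I \<cdot> V = 0\<close>, and \<open>I\<^sup>\<bottom>\<close> is an ideal containing all brackets. So \<open>V\<close> should be a
  double extension of \<open>I\<^sup>\<bottom> / I\<close> by the commutative algebra \<open>V / I\<^sup>\<bottom>\<close>, once a complement \<open>H\<close> of
  \<open>I\<^sup>\<bottom>\<close> is chosen. For every isotropic \<open>H\<close>, all but one of the identities required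
  of the data follow from the two facts about left multiplications above. The exception is the
  cyclic identity for \<open>L\<close>, which says that \<open>\<omega> (\<theta> a d) (\<theta> b c)\<close> is symmetric in \<open>a\<close> and \<open>b\<close>,
  which is not automatic. The remedy is to choose \<open>H\<close> inside a cyclic space \<open>M = \<E> l\<close>, where \<open>\<E>\<close> is
  the unital algebra generated by the left multiplications and \<open>l\<close> lies outside \<open>I\<^sup>\<bottom>\<close>. The elements of
  \<open>\<E>\<close> are self-adjoint and commute, so \<open>\<omega> (S l) (T l) = \<omega> l (S (T l)) = 0\<close> for \<open>S\<close>, \<open>T\<close> in
  \<open>\<E>\<close>: the space \<open>M\<close> is isotropic and stable, whence \<open>\<omega> (a \<cdot> b) c = 0\<close> on \<open>H\<close> and \<open>L = 0\<close>.
  Minimality of \<open>I\<close> gives \<open>I \<inter> M\<^sup>\<bottom> = {0}\<close>, that is \<open>M + I\<^sup>\<bottom> = V\<close>, so \<open>M\<close> does contain such an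
  \<open>H\<close> (\<open>dual_cyclic_subspace_exists\<close>).

  The reduced algebra lives on \<open>B = (H + I)\<^sup>\<bottom>\<close>, a subspace of smaller dimension
  (\<open>is_double_extension_reduced\<close>, \<open>double_extension_of_smaller\<close>), and induction on the dimension
  finishes the proof.
\<close>

section \<open>Linear algebra on finite-dimensional subspaces\<close>

context vector_space
begin

lemma fin_dim_subspace_basis:
  assumes "fin_dim_subspace scale V" "subspace U" "U \<subseteq> V"
  obtains C where "finite C" "independent C" "U = span C"
proof -
  obtain X where X: "finite X" "V = span X"
    using assms(1) by (auto simp: fin_dim_subspace_def)
  obtain C where C: "C \<subseteq> U" "independent C" "U \<subseteq> span C"
    by (rule maximal_independent_subset)
  have "finite C"
    using independent_span_bound[OF X(1) C(2)] C(1) assms(3) X(2) by blast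
  moreover have "U = span C"
    using C span_minimal[OF C(1) assms(2)] by blast
  ultimately show thesis
    using C(2) that by blast
qed

lemma fin_dim_subspace_imp_subspace: "fin_dim_subspace scale V \<Longrightarrow> subspace V"
  by (auto simp: fin_dim_subspace_def)

lemma fin_dim_subspace_mono:
  assumes "fin_dim_subspace scale V" "subspace U" "U \<subseteq> V"
  shows "fin_dim_subspace scale U"
  by (rule fin_dim_subspace_basis[OF assms]) (auto simp: fin_dim_subspace_def)

lemma fin_dim_dim_psubset:
  assumes V: "fin_dim_subspace scale V" and U: "subspace U" "U \<subset> V"
  shows "dim U < dim V"
proof -
  have sV: "subspace V"
    using V by (rule fin_dim_subspace_imp_subspace)
  obtain C where C: "finite C" "independent C" "U = span C"
    using fin_dim_subspace_basis[OF V U(1)] U(2) by blast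
  obtain D where D: "finite D" "independent D" "V = span D"
    using fin_dim_subspace_basis[OF V sV] by blast
  obtain x where x: "x \<in> V" "x \<notin> U"
    using U(2) by blast
  have "independent (insert x C)"
    using C x by (simp add: independent_insertI)
  moreover have "insert x C \<subseteq> span D"
    using x C D(3) U(2) span_superset by blast
  ultimately have "card (insert x C) \<le> card D"
    using independent_span_bound[OF D(1)] by blast
  moreover have "x \<notin> C"
    using x C(3) span_base by blast
  ultimately have "card C < card D"
    using C(1) by simp
  then show ?thesis
    unfolding C(3) D(3) dim_span_eq_card_independent[OF C(2)] dim_span_eq_card_independent[OF D(2)] .
qed

lemma projection_exists:
  assumes "subspace U"
  obtains P where "Vector_Spaces.linear scale scale P" "\<And>x. P x \<in> U" "\<And>x. x \<in> U \<Longrightarrow> P x = x"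
proof -
  interpret vector_space_pair scale scale ..
  have "Vector_Spaces.linear scale scale (\<lambda>x. x)"
    by unfold_locales simp_all
  then obtain P where "P ` UNIV \<subseteq> U" "Vector_Spaces.linear scale scale P" "\<forall>v\<in>U. P v = v"
    using linear_exists_left_inverse_on[of "\<lambda>x. x" U] assms by auto
  then show thesis
    using that by blast
qed

lemma linear_on_zero:
  assumes "subspace V" "linear_on scale s2 V W f" "vector_space s2"
  shows "f 0 = 0"
proof -
  interpret s2: vector_space s2 by fact
  have "f (scale 0 0) = s2 0 (f 0)"
    using assms(2) subspace_0[OF assms(1)] unfolding linear_on_def by blast
  then show ?thesis
    by simp
qed

lemma linear_on_sum:
  assumes "subspace V" "linear_on scale s2 V W f" "vector_space s2"
    and "finite C" "\<And>b. b \<in> C \<Longrightarrow> g b \<in> V"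
  shows "f (\<Sum>b\<in>C. scale (c b) (g b)) = (\<Sum>b\<in>C. s2 (c b) (f (g b)))"
  using assms(4,5)
proof (induction C)
  case empty
  then show ?case
    using linear_on_zero[OF assms(1-3)] by simp
next
  case (insert x C)
  have "(\<Sum>b\<in>C. scale (c b) (g b)) \<in> V" "scale (c x) (g x) \<in> V"
    using insert by (auto intro!: subspace_sum subspace_scale assms(1))
  then show ?case
    using insert assms(2) unfolding linear_on_def by simp
qed

text \<open>
  Pairing with a basis \<open>C\<close> turns \<open>z \<mapsto> \<omega> z\<close> into the endomorphism \<open>z \<mapsto> \<Sum>b\<in>C. \<omega> z b b\<close> of \<open>V\<close>;
  it is injective by nondegeneracy, hence surjective.
\<close>

lemma riesz_representation:
  assumes V: "fin_dim_subspace scale V" and \<omega>: "nondeg_skew_form scale V \<omega>"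
    and f: "linear_on scale (*) V UNIV f"
  obtains z where "z \<in> V" "\<And>x. x \<in> V \<Longrightarrow> \<omega> z x = f x"
proof -
  interpret vector_space_pair scale scale ..
  have K: "vector_space ((*) :: 'a \<Rightarrow> 'a \<Rightarrow> 'a)"
    by unfold_locales (auto simp: algebra_simps)
  have sV: "subspace V"
    using V by (rule fin_dim_subspace_imp_subspace)
  obtain C where C: "finite C" "independent C" "V = span C"
    using fin_dim_subspace_basis[OF V sV] by blast
  have CV: "C \<subseteq> V"
    using C(3) span_superset by blast
  have lin: "linear_on scale (*) V UNIV (\<omega> z)" if "z \<in> V" for z
    using \<omega> that by (auto simp: nondeg_skew_form_def bilinear_on_def)
  have lin': "linear_on scale (*) V UNIV (\<lambda>z. \<omega> z x)" if "x \<in> V" for x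
    using \<omega> that by (auto simp: nondeg_skew_form_def bilinear_on_def)
  have agree: "g x = h x"
    if "linear_on scale (*) V UNIV g" "linear_on scale (*) V UNIV h"
      "\<And>b. b \<in> C \<Longrightarrow> g b = h b" "x \<in> V" for g h :: "'b \<Rightarrow> 'a" and x
  proof -
    from \<open>x \<in> V\<close> obtain c where x: "x = (\<Sum>b\<in>C. scale (c b) b)"
      unfolding C(3) span_finite[OF C(1)] by auto
    have "g x = (\<Sum>b\<in>C. c b * g b)"
      unfolding x using CV by (intro linear_on_sum[OF sV that(1) K C(1)]) auto
    moreover have "h x = (\<Sum>b\<in>C. c b * h b)"
      unfolding x using CV by (intro linear_on_sum[OF sV that(2) K C(1)]) auto
    ultimately show ?thesis
      using that(3) by simp
  qed
  obtain P where P: "Vector_Spaces.linear scale scale P" "\<And>x. P x \<in> V" "\<And>x. x \<in> V \<Longrightarrow> P x = x"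
    using projection_exists[OF sV] by blast
  interpret P: Vector_Spaces.linear scale scale P by (rule P(1))
  define T where "T = (\<lambda>z. \<Sum>b\<in>C. scale (\<omega> (P z) b) b)"
  have \<omega>P: "\<omega> (P (x + y)) b = \<omega> (P x) b + \<omega> (P y) b" "\<omega> (P (scale c x)) b = c * \<omega> (P x) b"
    if "b \<in> C" for x y c b
    using lin'[of b] P(2) that CV unfolding linear_on_def P.add P.scale by auto
  have linT: "Vector_Spaces.linear scale scale T"
    by unfold_locales
      (auto simp: T_def \<omega>P scale_left_distrib sum.distrib scale_sum_right algebra_simps
        intro!: sum.cong)
  have coeff: "\<omega> z b = g b" if "T z = (\<Sum>b\<in>C. scale (g b) b)" "z \<in> V" "b \<in> C" for z g b
  proof -
    have "(\<Sum>b\<in>C. scale (\<omega> z b - g b) b) = 0"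
      using that P(3) by (simp add: T_def scale_left_diff_distrib sum_subtractf)
    then show ?thesis
      using independentD[OF C(2) C(1) subset_refl, of "\<lambda>b. \<omega> z b - g b"] that(3) by simp
  qed
  have zeroK: "linear_on scale (*) V UNIV (\<lambda>x. 0)"
    by (simp add: linear_on_def)
  have injT: "inj_on T V"
  proof -
    have "z = 0" if "z \<in> V" "T z = 0" for z
    proof -
      have "\<omega> z x = 0" if "x \<in> V" for x
        using coeff[of z "\<lambda>_. 0"] \<open>T z = 0\<close> \<open>z \<in> V\<close> by (intro agree[OF lin zeroK _ that]) auto
      then show ?thesis
        using \<omega> \<open>z \<in> V\<close> unfolding nondeg_skew_form_def by blast
    qed
    then show ?thesis
      using linear_inj_on_iff_eq_0[OF linT sV] by blast
  qed
  have TC: "independent (T ` C)" "card (T ` C) = card C"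
    using linear_independent_injective_image[OF linT C(2)] injT C(3) card_image[of T C]
      inj_on_subset[OF injT CV] by auto
  have "T ` C \<subseteq> span C"
    unfolding T_def by (auto intro: span_sum span_scale span_base)
  have "(\<Sum>b\<in>C. scale (f b) b) \<in> span (T ` C)"
  proof (rule ccontr)
    let ?y = "\<Sum>b\<in>C. scale (f b) b"
    assume y: "?y \<notin> span (T ` C)"
    have "independent (insert ?y (T ` C))"
      using y TC(1) by (simp add: independent_insertI)
    moreover have "insert ?y (T ` C) \<subseteq> span C"
      using \<open>T ` C \<subseteq> span C\<close> by (auto intro: span_sum span_scale span_base)
    ultimately have "card (insert ?y (T ` C)) \<le> card C"
      using independent_span_bound[OF C(1)] by blast
    moreover have "?y \<notin> T ` C"
      using y span_base by blast
    ultimately show False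
      using TC(2) C(1) by simp
  qed
  then obtain z where z: "z \<in> V" "T z = (\<Sum>b\<in>C. scale (f b) b)"
    unfolding linear_span_image[OF linT] C(3) by auto
  have "\<omega> z x = f x" if "x \<in> V" for x
    using coeff[OF z(2) z(1)] by (intro agree[OF lin[OF z(1)] f _ that]) auto
  then show thesis
    using z(1) that by blast
qed

text \<open>
  With \<open>P\<close> a projection onto \<open>U\<close> and \<open>w\<close> pairing nontrivially with \<open>x - P x\<close>, the functional
  \<open>y \<mapsto> \<omega> w (y - P y)\<close> kills \<open>U\<close> and not \<open>x\<close>; represent it.
\<close>

lemma orthogonal_separates:
  assumes V: "fin_dim_subspace scale V" and \<omega>: "nondeg_skew_form scale V \<omega>"
    and U: "subspace U" "U \<subseteq> V" and x: "x \<in> V" "x \<notin> U"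
  obtains z where "z \<in> orthogonal_on V \<omega> U" "\<omega> z x \<noteq> 0"
proof -
  have sV: "subspace V"
    using V by (rule fin_dim_subspace_imp_subspace)
  obtain P where P: "Vector_Spaces.linear scale scale P" "\<And>x. P x \<in> U" "\<And>x. x \<in> U \<Longrightarrow> P x = x"
    using projection_exists[OF U(1)] by blast
  interpret P: Vector_Spaces.linear scale scale P by (rule P(1))
  have PV: "y - P y \<in> V" if "y \<in> V" for y
    using that P(2) U(2) sV by (auto intro: subspace_diff)
  have "x - P x \<noteq> 0"
    using P(2)[of x] x(2) by auto
  then obtain w where w: "w \<in> V" "\<omega> w (x - P x) \<noteq> 0"
    using \<omega> PV[OF x(1)] unfolding nondeg_skew_form_def by (metis neg_0_equal_iff_equal)
  have lin: "linear_on scale (*) V UNIV (\<omega> w)"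
    using \<omega> w(1) by (auto simp: nondeg_skew_form_def bilinear_on_def)
  have "linear_on scale (*) V UNIV (\<lambda>y. \<omega> w (y - P y))"
    unfolding linear_on_def
  proof (intro conjI ballI allI)
    fix y y' assume "y \<in> V" "y' \<in> V"
    then have "\<omega> w ((y - P y) + (y' - P y')) = \<omega> w (y - P y) + \<omega> w (y' - P y')"
      using lin PV unfolding linear_on_def by blast
    then show "\<omega> w (y + y' - P (y + y')) = \<omega> w (y - P y) + \<omega> w (y' - P y')"
      by (simp add: P.add algebra_simps)
  next
    fix c y assume "y \<in> V"
    then have "\<omega> w (scale c (y - P y)) = c * \<omega> w (y - P y)"
      using lin PV unfolding linear_on_def by blast
    then show "\<omega> w (scale c y - P (scale c y)) = c * \<omega> w (y - P y)"
      by (simp add: P.scale scale_right_diff_distrib)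
  qed auto
  then obtain z where z: "z \<in> V" "\<And>y. y \<in> V \<Longrightarrow> \<omega> z y = \<omega> w (y - P y)"
    using riesz_representation[OF V \<omega>] by blast
  have "\<omega> w 0 = 0"
    using linear_on_zero[OF sV lin] by (simp add: vector_space_def algebra_simps)
  then have "z \<in> orthogonal_on V \<omega> U"
    using z P(3) U(2) by (auto simp: orthogonal_on_def)
  moreover have "\<omega> z x \<noteq> 0"
    using z(2)[OF x(1)] w(2) by simp
  ultimately show thesis
    by (rule that)
qed

lemma adjoint_on_unique:
  assumes \<omega>: "nondeg_skew_form scale V \<omega>" and sV: "subspace V"
    and z: "z \<in> V" "\<And>x. x \<in> V \<Longrightarrow> \<omega> (T x) y = \<omega> x z"
  shows "adjoint_on V \<omega> T y = z"
  unfolding adjoint_on_def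
proof (rule the_equality)
  fix z' assume z': "z' \<in> V \<and> (\<forall>x\<in>V. \<omega> (T x) y = \<omega> x z')"
  have "\<omega> (z' - z) x = 0" if x: "x \<in> V" for x
  proof -
    have "linear_on scale (*) V UNIV (\<lambda>z. \<omega> z x)"
      using \<omega> x by (auto simp: nondeg_skew_form_def bilinear_on_def)
    moreover have "z' - z \<in> V"
      using z z' sV subspace_diff by blast
    ultimately have "\<omega> (z' - z + z) x = \<omega> (z' - z) x + \<omega> z x"
      using z(1) unfolding linear_on_def by blast
    moreover have "\<omega> z' x = \<omega> z x"
      using \<omega> z z' x unfolding nondeg_skew_form_def by metis
    ultimately show ?thesis
      by simp
  qed
  moreover have "z' - z \<in> V"
    using z(1) z' sV subspace_diff by blast
  ultimately have "z' - z = 0"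
    using \<omega> unfolding nondeg_skew_form_def by blast
  then show "z' = z"
    by simp
qed (use z in auto)

lemma adjoint_on_works:
  assumes V: "fin_dim_subspace scale V" and \<omega>: "nondeg_skew_form scale V \<omega>"
    and T: "linear_on scale scale V V T" and y: "y \<in> V"
  shows "adjoint_on V \<omega> T y \<in> V" "\<And>x. x \<in> V \<Longrightarrow> \<omega> (T x) y = \<omega> x (adjoint_on V \<omega> T y)"
proof -
  have sV: "subspace V"
    using V by (rule fin_dim_subspace_imp_subspace)
  have "linear_on scale (*) V UNIV (\<lambda>x. \<omega> y (T x))"
  proof -
    have "linear_on scale (*) V UNIV (\<omega> y)"
      using \<omega> y by (auto simp: nondeg_skew_form_def bilinear_on_def)
    then show ?thesis
      using T by (simp add: linear_on_def)
  qed
  then obtain z where z: "z \<in> V" "\<And>x. x \<in> V \<Longrightarrow> \<omega> z x = \<omega> y (T x)"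
    using riesz_representation[OF V \<omega>] by blast
  have *: "\<omega> (T x) y = \<omega> x z" if "x \<in> V" for x
  proof -
    have "T x \<in> V"
      using T that by (auto simp: linear_on_def)
    then have "\<omega> (T x) y = - \<omega> y (T x)" "\<omega> x z = - \<omega> z x"
      using \<omega> y z(1) that unfolding nondeg_skew_form_def by blast+
    then show ?thesis
      using z(2)[OF that] by simp
  qed
  show "adjoint_on V \<omega> T y \<in> V" "\<And>x. x \<in> V \<Longrightarrow> \<omega> (T x) y = \<omega> x (adjoint_on V \<omega> T y)"
    using adjoint_on_unique[OF \<omega> sV z(1) *] z(1) * by auto
qed

end

section \<open>Commuting left multiplications and the left kernel\<close>

locale pre_symplectic_algebra = vector_space scale
  for scale :: "'k::field_char_0 \<Rightarrow> 'v::ab_group_add \<Rightarrow> 'v" +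
  fixes A :: "('v, 'k) form_alg"
  assumes pre_symplectic: "pre_symplectic_lsa scale A"
begin

abbreviation "V \<equiv> carrier A"
abbreviation prod (infixl "\<cdot>" 70) where "u \<cdot> v \<equiv> mul A u v"
abbreviation "\<omega> \<equiv> form A"
abbreviation orth ("_\<^sup>\<bottom>" [1000] 999) where "U\<^sup>\<bottom> \<equiv> orthogonal_on V \<omega> U"

lemma fin_dim_V: "fin_dim_subspace scale V"
  using pre_symplectic by (simp add: pre_symplectic_lsa_def left_symmetric_alg_def is_alg_def)

lemma subspace_V: "subspace V"
  using fin_dim_V by (rule fin_dim_subspace_imp_subspace)

lemma nondeg_form: "nondeg_skew_form scale V \<omega>"
  using pre_symplectic by (simp add: pre_symplectic_lsa_def)

lemma V_closed [simp, intro]: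
  "0 \<in> V"
  "\<lbrakk>x \<in> V; y \<in> V\<rbrakk> \<Longrightarrow> x + y \<in> V"
  "\<lbrakk>x \<in> V; y \<in> V\<rbrakk> \<Longrightarrow> x - y \<in> V"
  "x \<in> V \<Longrightarrow> - x \<in> V"
  "x \<in> V \<Longrightarrow> scale c x \<in> V"
  using subspace_V by (auto intro: subspace_0 subspace_add subspace_diff subspace_neg subspace_scale)

lemma bilinear_prod: "bilinear_on scale scale scale V V V (mul A)"
  using pre_symplectic by (simp add: pre_symplectic_lsa_def left_symmetric_alg_def is_alg_def)

lemma prod_closed [simp, intro]: "\<lbrakk>u \<in> V; v \<in> V\<rbrakk> \<Longrightarrow> u \<cdot> v \<in> V"
  using bilinear_prod unfolding bilinear_on_def linear_on_def by blast

lemma prod_add: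
  "\<lbrakk>u \<in> V; v \<in> V; w \<in> V\<rbrakk> \<Longrightarrow> (u + v) \<cdot> w = u \<cdot> w + v \<cdot> w"
  "\<lbrakk>u \<in> V; v \<in> V; w \<in> V\<rbrakk> \<Longrightarrow> u \<cdot> (v + w) = u \<cdot> v + u \<cdot> w"
  using bilinear_prod unfolding bilinear_on_def linear_on_def by blast+

lemma prod_scale:
  "\<lbrakk>u \<in> V; v \<in> V\<rbrakk> \<Longrightarrow> scale c u \<cdot> v = scale c (u \<cdot> v)"
  "\<lbrakk>u \<in> V; v \<in> V\<rbrakk> \<Longrightarrow> u \<cdot> scale c v = scale c (u \<cdot> v)"
  using bilinear_prod unfolding bilinear_on_def linear_on_def by blast+

lemma prod_zero [simp]: "u \<in> V \<Longrightarrow> 0 \<cdot> u = 0" "u \<in> V \<Longrightarrow> u \<cdot> 0 = 0"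
  using prod_scale[of 0 u 0] prod_scale[of u 0 0] by auto

lemma prod_diff:
  "\<lbrakk>u \<in> V; v \<in> V; w \<in> V\<rbrakk> \<Longrightarrow> (u - v) \<cdot> w = u \<cdot> w - v \<cdot> w"
  "\<lbrakk>u \<in> V; v \<in> V; w \<in> V\<rbrakk> \<Longrightarrow> u \<cdot> (v - w) = u \<cdot> v - u \<cdot> w"
  using prod_add(1)[of "u - v" v w] prod_add(2)[of u "v - w" w] by auto

lemma form_bilinear: "bilinear_on scale scale (*) V V UNIV \<omega>"
  using nondeg_form unfolding nondeg_skew_form_def by blast

lemma form_add:
  "\<lbrakk>u \<in> V; v \<in> V; w \<in> V\<rbrakk> \<Longrightarrow> \<omega> (u + v) w = \<omega> u w + \<omega> v w"
  "\<lbrakk>u \<in> V; v \<in> V; w \<in> V\<rbrakk> \<Longrightarrow> \<omega> u (v + w) = \<omega> u v + \<omega> u w"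
  using form_bilinear unfolding bilinear_on_def linear_on_def by blast+

lemma form_scale:
  "\<lbrakk>u \<in> V; v \<in> V\<rbrakk> \<Longrightarrow> \<omega> (scale c u) v = c * \<omega> u v"
  "\<lbrakk>u \<in> V; v \<in> V\<rbrakk> \<Longrightarrow> \<omega> u (scale c v) = c * \<omega> u v"
  using form_bilinear unfolding bilinear_on_def linear_on_def by blast+

lemma form_zero [simp]: "u \<in> V \<Longrightarrow> \<omega> 0 u = 0" "u \<in> V \<Longrightarrow> \<omega> u 0 = 0"
  using form_scale[of 0 u 0] form_scale[of u 0 0] by auto

lemma form_diff:
  "\<lbrakk>u \<in> V; v \<in> V; w \<in> V\<rbrakk> \<Longrightarrow> \<omega> (u - v) w = \<omega> u w - \<omega> v w"
  "\<lbrakk>u \<in> V; v \<in> V; w \<in> V\<rbrakk> \<Longrightarrow> \<omega> u (v - w) = \<omega> u v - \<omega> u w"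
  using form_add(1)[of "u - v" v w] form_add(2)[of u "v - w" w] by auto

lemma form_skew: "\<lbrakk>u \<in> V; v \<in> V\<rbrakk> \<Longrightarrow> \<omega> u v = - \<omega> v u"
  using nondeg_form unfolding nondeg_skew_form_def by blast

lemma form_self [simp]: "u \<in> V \<Longrightarrow> \<omega> u u = 0"
  using form_skew[of u u] by simp

lemma form_nondeg: "\<lbrakk>u \<in> V; \<And>v. v \<in> V \<Longrightarrow> \<omega> u v = 0\<rbrakk> \<Longrightarrow> u = 0"
  using nondeg_form unfolding nondeg_skew_form_def by blast

lemma left_mul_adjoint: "\<lbrakk>u \<in> V; v \<in> V; w \<in> V\<rbrakk> \<Longrightarrow> \<omega> (u \<cdot> v) w = \<omega> v (u \<cdot> w)"
  using pre_symplectic unfolding pre_symplectic_lsa_def left_mul_symmetric_def by blast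

lemma left_symmetric:
  "\<lbrakk>u \<in> V; v \<in> V; w \<in> V\<rbrakk> \<Longrightarrow>
    (u \<cdot> v) \<cdot> w - u \<cdot> (v \<cdot> w) = (v \<cdot> u) \<cdot> w - v \<cdot> (u \<cdot> w)"
  using pre_symplectic unfolding pre_symplectic_lsa_def left_symmetric_alg_def by blast

text \<open>
  Left symmetry says \<open>L\<^bsub>[u,v]\<^esub> = L\<^sub>u L\<^sub>v - L\<^sub>v L\<^sub>u\<close>. The left side is self-adjoint for \<open>\<omega>\<close>,
  the right side, a commutator of self-adjoint operators, is anti-self-adjoint; so both vanish.
\<close>

lemma bracket_mul_zero:
  assumes "u \<in> V" "v \<in> V" "w \<in> V"
  shows "(u \<cdot> v - v \<cdot> u) \<cdot> w = 0"
proof (rule form_nondeg)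
  let ?d = "u \<cdot> v - v \<cdot> u"
  have comm: "?d \<cdot> x = u \<cdot> (v \<cdot> x) - v \<cdot> (u \<cdot> x)" if "x \<in> V" for x
    using left_symmetric[OF assms(1,2) that] assms that by (simp add: prod_diff algebra_simps)
  fix x assume x: "x \<in> V"
  have "\<omega> (?d \<cdot> w) x = \<omega> w (?d \<cdot> x)"
    using assms x by (intro left_mul_adjoint) auto
  moreover have "\<omega> (?d \<cdot> w) x = \<omega> w (v \<cdot> (u \<cdot> x)) - \<omega> w (u \<cdot> (v \<cdot> x))"
    using assms x by (simp add: comm form_diff left_mul_adjoint)
  moreover have "\<omega> w (?d \<cdot> x) = \<omega> w (u \<cdot> (v \<cdot> x)) - \<omega> w (v \<cdot> (u \<cdot> x))"
    using assms x by (simp add: comm form_diff)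
  ultimately show "\<omega> (?d \<cdot> w) x = 0"
    by (simp add: algebra_simps flip: mult_2)
qed (use assms in auto)

lemma prod_commute_left_factor:
  "\<lbrakk>u \<in> V; v \<in> V; w \<in> V\<rbrakk> \<Longrightarrow> (u \<cdot> v) \<cdot> w = (v \<cdot> u) \<cdot> w"
  using bracket_mul_zero[of u v w] by (simp add: prod_diff)

lemma left_mul_commute:
  "\<lbrakk>u \<in> V; v \<in> V; w \<in> V\<rbrakk> \<Longrightarrow> u \<cdot> (v \<cdot> w) = v \<cdot> (u \<cdot> w)"
  using left_symmetric[of u v w] prod_commute_left_factor[of u v w] by simp

text \<open>
  A two-sided ideal that contains all brackets; it witnesses the Milnor property when it is
  nondegenerate.
\<close>

definition left_kernel :: "'v set" where
  "left_kernel = {x\<in>V. \<forall>v\<in>V. x \<cdot> v = 0}"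

definition invariant :: "'v set \<Rightarrow> bool" where
  "invariant U \<longleftrightarrow> subspace U \<and> U \<subseteq> V \<and> (\<forall>u\<in>V. \<forall>x\<in>U. u \<cdot> x \<in> U)"

lemma orthogonalD: "x \<in> U\<^sup>\<bottom> \<Longrightarrow> x \<in> V" "\<lbrakk>x \<in> U\<^sup>\<bottom>; y \<in> U\<rbrakk> \<Longrightarrow> \<omega> x y = 0"
  by (auto simp: orthogonal_on_def)

lemma subspace_orthogonal: "U \<subseteq> V \<Longrightarrow> subspace (U\<^sup>\<bottom>)"
  by (rule subspaceI) (auto simp: orthogonal_on_def form_add form_scale subset_iff)

lemma orthogonal_subset: "U\<^sup>\<bottom> \<subseteq> V"
  by (auto simp: orthogonal_on_def)

lemma orthogonal_antimono: "U \<subseteq> W \<Longrightarrow> W\<^sup>\<bottom> \<subseteq> U\<^sup>\<bottom>"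
  by (auto simp: orthogonal_on_def)

lemma subset_orthogonal_sym:
  assumes "U \<subseteq> V" "W \<subseteq> U\<^sup>\<bottom>"
  shows "U \<subseteq> W\<^sup>\<bottom>"
proof
  fix x assume x: "x \<in> U"
  have "\<omega> x y = 0" if "y \<in> W" for y
  proof -
    have "\<omega> y x = 0" "y \<in> V"
      using x that assms(2) by (auto simp: orthogonal_on_def)
    then show ?thesis
      using form_skew[of x y] x assms(1) by auto
  qed
  then show "x \<in> W\<^sup>\<bottom>"
    using x assms(1) by (auto simp: orthogonal_on_def)
qed

lemma invariant_orthogonal: "invariant U \<Longrightarrow> invariant (U\<^sup>\<bottom>)"
  unfolding invariant_def
  by (auto simp: subspace_orthogonal) (auto simp: orthogonal_on_def left_mul_adjoint subset_iff)

lemma invariant_Int: "\<lbrakk>invariant U; invariant W\<rbrakk> \<Longrightarrow> invariant (U \<inter> W)"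
  by (auto simp: invariant_def subspace_inter)

lemma bracket_in_left_kernel: "\<lbrakk>u \<in> V; v \<in> V\<rbrakk> \<Longrightarrow> u \<cdot> v - v \<cdot> u \<in> left_kernel"
  by (simp add: left_kernel_def bracket_mul_zero)

lemma invariant_left_kernel: "invariant left_kernel"
  unfolding invariant_def
proof (intro conjI ballI)
  show "subspace left_kernel"
    by (rule subspaceI) (auto simp: left_kernel_def prod_add prod_scale)
  fix u x assume "u \<in> V" "x \<in> left_kernel"
  then show "u \<cdot> x \<in> left_kernel"
    by (auto simp: left_kernel_def prod_commute_left_factor[of u x])
qed (auto simp: left_kernel_def)

lemma orthogonal_orthogonal:
  assumes "subspace U" "U \<subseteq> V"
  shows "(U\<^sup>\<bottom>)\<^sup>\<bottom> = U"
proof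
  show "U \<subseteq> (U\<^sup>\<bottom>)\<^sup>\<bottom>"
    by (rule subset_orthogonal_sym[OF assms(2) subset_refl])
  show "(U\<^sup>\<bottom>)\<^sup>\<bottom> \<subseteq> U"
  proof
    fix x assume x: "x \<in> (U\<^sup>\<bottom>)\<^sup>\<bottom>"
    show "x \<in> U"
    proof (rule ccontr)
      assume "x \<notin> U"
      then obtain z where z: "z \<in> U\<^sup>\<bottom>" "\<omega> z x \<noteq> 0"
        using orthogonal_separates[OF fin_dim_V nondeg_form assms] x by (auto simp: orthogonal_on_def)
      then show False
        using x form_skew[of z x] by (auto simp: orthogonal_on_def)
    qed
  qed
qed

text \<open>
  Right multiplication by an element orthogonal to all brackets is anti-self-adjoint. Its interplay
  with the self-adjoint left multiplications kills products in \<open>left_kernel\<^sup>\<bottom>\<close>.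
\<close>

lemma right_mul_skew:
  assumes "\<And>u v. \<lbrakk>u \<in> V; v \<in> V\<rbrakk> \<Longrightarrow> \<omega> (u \<cdot> v) x = \<omega> (v \<cdot> u) x" and "x \<in> V" "u \<in> V" "v \<in> V"
  shows "\<omega> (u \<cdot> x) v = - \<omega> u (v \<cdot> x)"
proof -
  have "\<omega> (u \<cdot> x) v = \<omega> x (u \<cdot> v)"
    using assms by (intro left_mul_adjoint) auto
  also have "\<dots> = - \<omega> (u \<cdot> v) x"
    using assms by (intro form_skew) auto
  also have "\<dots> = - \<omega> (v \<cdot> u) x"
    using assms by simp
  also have "\<dots> = - \<omega> u (v \<cdot> x)"
    using assms by (simp add: left_mul_adjoint)
  finally show ?thesis .
qed

lemma orthogonal_left_kernel_bracket:
  assumes "x \<in> left_kernel\<^sup>\<bottom>" "u \<in> V" "v \<in> V"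
  shows "\<omega> (u \<cdot> v) x = \<omega> (v \<cdot> u) x"
proof -
  have x: "x \<in> V"
    using assms(1) by (rule orthogonalD)
  have "\<omega> x (u \<cdot> v - v \<cdot> u) = 0"
    using assms bracket_in_left_kernel orthogonalD(2) by blast
  then have "\<omega> x (u \<cdot> v) = \<omega> x (v \<cdot> u)"
    using assms x by (simp add: form_diff)
  then show ?thesis
    using form_skew[of x "u \<cdot> v"] form_skew[of x "v \<cdot> u"] x assms by simp
qed

text \<open>
  The bracket of \<open>x\<close> and \<open>y\<close> lies in \<open>left_kernel\<close> and in the left ideal \<open>left_kernel\<^sup>\<bottom>\<close>, so
  \<open>x \<cdot> y = y \<cdot> x\<close>. As \<open>R\<^sub>x\<close> and \<open>R\<^sub>y\<close> are anti-self-adjoint and left multiplications self-adjoint,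
  moving factors across \<open>\<omega>\<close> gives \<open>\<omega> (x \<cdot> y) z = \<omega> z (y \<cdot> x) = - \<omega> (x \<cdot> y) z\<close>.
\<close>

lemma orthogonal_left_kernel_prod_zero:
  assumes nondeg: "left_kernel \<inter> left_kernel\<^sup>\<bottom> = {0}"
    and x: "x \<in> left_kernel\<^sup>\<bottom>" and y: "y \<in> left_kernel\<^sup>\<bottom>"
  shows "x \<cdot> y = 0"
proof -
  note V = orthogonalD(1)[OF x] orthogonalD(1)[OF y]
  have inv: "invariant (left_kernel\<^sup>\<bottom>)"
    by (intro invariant_orthogonal invariant_left_kernel)
  then have inK: "x \<cdot> y \<in> left_kernel\<^sup>\<bottom>" "y \<cdot> x \<in> left_kernel\<^sup>\<bottom>"
    using V x y by (auto simp: invariant_def)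
  then have "x \<cdot> y - y \<cdot> x \<in> left_kernel \<inter> left_kernel\<^sup>\<bottom>"
    using V inv by (auto simp: invariant_def bracket_in_left_kernel subspace_diff)
  then have comm: "x \<cdot> y = y \<cdot> x"
    using nondeg by simp
  show ?thesis
  proof (rule form_nondeg)
    fix z assume z: "z \<in> V"
    have "\<omega> (x \<cdot> y) z = - \<omega> x (z \<cdot> y)"
      using orthogonal_left_kernel_bracket[OF y] V z by (intro right_mul_skew) auto
    also have "\<dots> = - \<omega> (z \<cdot> x) y"
      using V z by (simp add: left_mul_adjoint)
    also have "\<dots> = \<omega> z (y \<cdot> x)"
      using orthogonal_left_kernel_bracket[OF x] V z by (subst right_mul_skew) auto
    also have "\<dots> = - \<omega> (x \<cdot> y) z"
      using comm form_skew[of z "y \<cdot> x"] V z by simp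
    finally show "\<omega> (x \<cdot> y) z = 0"
      by simp
  qed (use V in auto)
qed

text \<open>The orthogonal of \<open>U + W\<close> is \<open>U\<^sup>\<bottom> \<inter> W\<^sup>\<bottom> = {0}\<close>, so \<open>U + W\<close>, its own double orthogonal, is \<open>V\<close>.\<close>

lemma sum_eq_V_if_orthogonals_disjoint:
  assumes U: "subspace U" "U \<subseteq> V" and W: "subspace W" "W \<subseteq> V"
    and x: "x \<in> V" and disj: "U\<^sup>\<bottom> \<inter> W\<^sup>\<bottom> \<subseteq> {0}"
  obtains a where "a \<in> U" "x - a \<in> W"
proof -
  let ?S = "{a + b |a b. a \<in> U \<and> b \<in> W}"
  have sS: "subspace ?S"
    by (intro subspace_sums U W)
  have SV: "?S \<subseteq> V"
    using U(2) W(2) by auto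
  have "U \<subseteq> ?S" "W \<subseteq> ?S"
    using subspace_0[OF U(1)] subspace_0[OF W(1)] by force+
  then have "?S\<^sup>\<bottom> \<subseteq> U\<^sup>\<bottom> \<inter> W\<^sup>\<bottom>"
    by (intro Int_greatest orthogonal_antimono)
  then have "?S\<^sup>\<bottom> \<subseteq> {0}"
    using disj by blast
  then have "x \<in> (?S\<^sup>\<bottom>)\<^sup>\<bottom>"
    using x by (auto simp: orthogonal_on_def[of V \<omega> "?S\<^sup>\<bottom>"])
  then obtain a b where "a \<in> U" "b \<in> W" "x = a + b"
    using orthogonal_orthogonal[OF sS SV] by blast
  then show thesis
    by (intro that[of a]) simp_all
qed

text \<open>
  When \<open>V = K \<oplus> K\<^sup>\<bottom>\<close> for the left kernel \<open>K\<close>, the only surviving products are those in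
  \<open>K\<^sup>\<bottom> \<cdot> K\<close>, and they lie in the ideal \<open>K\<close>. The Jacobi identity holds because left
  multiplications commute and brackets multiply to zero from the left.
\<close>

proposition milnor_if_left_kernel_nondegenerate:
  assumes nondeg: "left_kernel \<inter> left_kernel\<^sup>\<bottom> = {0}"
  shows "milnor_pre_symplectic scale A"
proof -
  have K: "subspace left_kernel" "left_kernel \<subseteq> V"
    using invariant_left_kernel by (auto simp: invariant_def)
  have ideal: "two_sided_ideal scale A left_kernel"
    using invariant_left_kernel subspace_0[OF K(1)]
    by (auto simp: two_sided_ideal_def invariant_def) (auto simp: left_kernel_def)
  have prodK: "u \<cdot> v \<in> left_kernel" if uv: "u \<in> V" "v \<in> V" for u v
  proof -
    have split: "\<exists>a b. a \<in> left_kernel \<and> b \<in> left_kernel\<^sup>\<bottom> \<and> x = a + b" if x: "x \<in> V" for x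
    proof -
      have "left_kernel\<^sup>\<bottom> \<inter> (left_kernel\<^sup>\<bottom>)\<^sup>\<bottom> \<subseteq> {0}"
        using nondeg orthogonal_orthogonal[OF K] by blast
      then obtain a where "a \<in> left_kernel" "x - a \<in> left_kernel\<^sup>\<bottom>"
        by (rule sum_eq_V_if_orthogonals_disjoint
            [OF K subspace_orthogonal[OF K(2)] orthogonal_subset x])
      then show ?thesis
        by (intro exI[of _ a] exI[of _ "x - a"]) simp
    qed
    obtain a b where ab: "a \<in> left_kernel" "b \<in> left_kernel\<^sup>\<bottom>" "u = a + b"
      using split[OF uv(1)] by blast
    obtain c d where cd: "c \<in> left_kernel" "d \<in> left_kernel\<^sup>\<bottom>" "v = c + d"
      using split[OF uv(2)] by blast
    have V: "a \<in> V" "b \<in> V" "c \<in> V" "d \<in> V"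
      using ab cd K(2) by (auto simp: orthogonal_on_def)
    have "u \<cdot> v = b \<cdot> c"
      using ab cd V orthogonal_left_kernel_prod_zero[OF nondeg ab(2) cd(2)]
      by (simp add: prod_add left_kernel_def)
    then show ?thesis
      using V cd invariant_left_kernel by (simp add: invariant_def)
  qed
  have lie: "lie_bracket_on scale V (bracket A)"
    unfolding lie_bracket_on_def
  proof (intro conjI ballI)
    show "bilinear_on scale scale scale V V V (bracket A)"
      by (auto simp: bilinear_on_def linear_on_def bracket_def prod_add prod_scale
          scale_right_diff_distrib algebra_simps)
    fix u v w assume V: "u \<in> V" "v \<in> V" "w \<in> V"
    have "bracket A x (bracket A y z) = x \<cdot> (y \<cdot> z) - x \<cdot> (z \<cdot> y)"
      if "x \<in> V" "y \<in> V" "z \<in> V" for x y z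
      using that bracket_mul_zero[of y z x] by (simp add: bracket_def prod_diff)
    then show "bracket A u (bracket A v w) + bracket A v (bracket A w u) +
        bracket A w (bracket A u v) = 0"
      using V left_mul_commute[of u v w] left_mul_commute[of u w v] left_mul_commute[of v w u]
      by simp
  qed (auto simp: bracket_def)
  show ?thesis
    unfolding milnor_pre_symplectic_def
    using fin_dim_V bilinear_prod nondeg_form lie ideal nondeg prodK pre_symplectic
    by (auto simp: is_alg_def pre_symplectic_lsa_def intro!: exI[of _ left_kernel])
      (auto simp: left_kernel_def)
qed

section \<open>A minimal isotropic ideal and a cyclic isotropic subspace dual to it\<close>

text \<open>
  This is \<open>\<E> l\<close>, where \<open>\<E>\<close> is the unital algebra generated by the left multiplications; a list
  \<open>us\<close> encodes the monomial \<open>L u\<^sub>1 \<dots> L u\<^sub>k\<close>.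
\<close>

definition cyclic_subspace :: "'v \<Rightarrow> 'v set" where
  "cyclic_subspace l = span {foldr (mul A) us l |us. set us \<subseteq> V}"

lemma foldr_mul_closed: "\<lbrakk>set us \<subseteq> V; x \<in> V\<rbrakk> \<Longrightarrow> foldr (mul A) us x \<in> V"
  by (induction us) auto

lemma foldr_mul_commute:
  "\<lbrakk>set us \<subseteq> V; x \<in> V; u \<in> V\<rbrakk> \<Longrightarrow> foldr (mul A) us (u \<cdot> x) = u \<cdot> foldr (mul A) us x"
  by (induction us) (auto simp: foldr_mul_closed left_mul_commute)

lemma foldr_mul_adjoint:
  assumes "set us \<subseteq> V" "x \<in> V" "y \<in> V"
  shows "\<omega> (foldr (mul A) us x) y = \<omega> x (foldr (mul A) us y)"
  using assms
proof (induction us arbitrary: y)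
  case (Cons u us)
  then show ?case
    by (simp add: foldr_mul_closed foldr_mul_commute left_mul_adjoint)
qed auto

text \<open>
  Left multiplications commute, so each of their monomials \<open>T\<close> is self-adjoint; then
  \<open>\<omega> l (T l) = \<omega> (T l) l = - \<omega> l (T l)\<close> vanishes. This makes every cyclic subspace isotropic.
\<close>

lemma form_foldr_mul_self:
  assumes "set us \<subseteq> V" "set vs \<subseteq> V" "l \<in> V"
  shows "\<omega> (foldr (mul A) us l) (foldr (mul A) vs l) = 0"
proof -
  let ?T = "foldr (mul A) (us @ vs)"
  have T: "?T l \<in> V" "\<omega> (?T l) l = \<omega> l (?T l)"
    using assms foldr_mul_closed[of "us @ vs"] foldr_mul_adjoint[of "us @ vs"] by auto
  have "\<omega> (foldr (mul A) us l) (foldr (mul A) vs l) = \<omega> l (?T l)"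
    using assms by (simp add: foldr_mul_adjoint foldr_mul_closed)
  also have "\<dots> = 0"
    using form_skew[OF assms(3) T(1)] T(2) by simp
  finally show ?thesis .
qed

lemma cyclic_subspace:
  assumes l: "l \<in> V"
  shows "l \<in> cyclic_subspace l" and "invariant (cyclic_subspace l)"
    and "\<lbrakk>x \<in> cyclic_subspace l; y \<in> cyclic_subspace l\<rbrakk> \<Longrightarrow> \<omega> x y = 0"
proof -
  let ?G = "{foldr (mul A) us l |us. set us \<subseteq> V}"
  have "foldr (mul A) [] l \<in> ?G"
    by (intro CollectI exI[of _ "[]"]) simp
  then show "l \<in> cyclic_subspace l"
    unfolding cyclic_subspace_def by (auto intro: span_base)
  have GV: "?G \<subseteq> V"
    using l by (auto intro: foldr_mul_closed)
  then have MV: "cyclic_subspace l \<subseteq> V"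
    unfolding cyclic_subspace_def by (rule span_minimal) (rule subspace_V)
  have "u \<cdot> x \<in> cyclic_subspace l" if u: "u \<in> V" and x: "x \<in> span ?G" for u x
  proof -
    have "span ?G \<subseteq> {x\<in>V. u \<cdot> x \<in> span ?G}"
    proof (rule span_minimal)
      show "?G \<subseteq> {x\<in>V. u \<cdot> x \<in> span ?G}"
      proof clarify
        fix us assume us: "set us \<subseteq> V"
        have "foldr (mul A) (u # us) l \<in> ?G"
          using us u by (intro CollectI exI[of _ "u # us"]) simp
        then have "u \<cdot> foldr (mul A) us l \<in> span ?G"
          by (simp add: span_base)
        then show "foldr (mul A) us l \<in> V \<and> u \<cdot> foldr (mul A) us l \<in> span ?G"
          using us l foldr_mul_closed by blast
      qed
      show "subspace {x\<in>V. u \<cdot> x \<in> span ?G}"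
        using u by (intro subspaceI) (auto simp: prod_add prod_scale span_zero span_add span_scale)
    qed
    then show ?thesis
      using x by (auto simp: cyclic_subspace_def)
  qed
  then show "invariant (cyclic_subspace l)"
    using MV by (auto simp: invariant_def) (auto simp: cyclic_subspace_def)
  have "?G \<subseteq> ?G\<^sup>\<bottom>"
    using GV by (auto simp: orthogonal_on_def form_foldr_mul_self l)
  then have "span ?G \<subseteq> ?G\<^sup>\<bottom>"
    by (rule span_minimal) (rule subspace_orthogonal[OF GV])
  then have "?G \<subseteq> (span ?G)\<^sup>\<bottom>"
    by (rule subset_orthogonal_sym[OF GV])
  then have "span ?G \<subseteq> (span ?G)\<^sup>\<bottom>"
    using subspace_orthogonal[of "span ?G"] MV by (intro span_minimal) (auto simp: cyclic_subspace_def)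
  then show "\<omega> x y = 0" if "x \<in> cyclic_subspace l" "y \<in> cyclic_subspace l"
    using that by (auto simp: cyclic_subspace_def orthogonal_on_def)
qed

lemma minimal_invariant_exists:
  assumes "invariant U" "U \<noteq> {0}"
  obtains I where "invariant I" "I \<noteq> {0}" "I \<subseteq> U" "\<And>J. \<lbrakk>invariant J; J \<subset> I\<rbrakk> \<Longrightarrow> J = {0}"
proof -
  let ?P = "\<lambda>I. invariant I \<and> I \<noteq> {0} \<and> I \<subseteq> U"
  define I where "I = arg_min dim ?P"
  have "?P U"
    using assms by simp
  then have I: "?P I"
    unfolding I_def by (rule arg_min_natI)
  have I_min: "dim I \<le> dim J" if "?P J" for J
    unfolding I_def using that by (rule arg_min_nat_le)
  have "J = {0}" if J: "invariant J" "J \<subset> I" for J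
  proof (rule ccontr)
    assume "J \<noteq> {0}"
    then have "dim I \<le> dim J"
      using I I_min J by blast
    moreover have "dim J < dim I"
      using I J fin_dim_dim_psubset[of I J] fin_dim_subspace_mono[OF fin_dim_V, of I]
      by (auto simp: invariant_def)
    ultimately show False
      by simp
  qed
  then show thesis
    using I that by blast
qed

text \<open>
  The projection along \<open>W\<close> onto a complement of \<open>M \<inter> W\<close> in \<open>M\<close>; that complement, the
  kernel in \<open>M\<close> of a projection \<open>P\<close> onto \<open>M \<inter> W\<close>, is also a complement of \<open>W\<close> in \<open>V\<close>.
\<close>

lemma projection_along:
  assumes M: "subspace M" "M \<subseteq> V" and W: "subspace W" "W \<subseteq> V"
    and sum: "\<And>x. x \<in> V \<Longrightarrow> \<exists>m\<in>M. x - m \<in> W"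
  obtains q where "linear_on scale scale V V q" "\<And>x. x \<in> V \<Longrightarrow> q x \<in> M"
    "\<And>x. x \<in> V \<Longrightarrow> x - q x \<in> W" "\<And>x. x \<in> W \<Longrightarrow> q x = 0"
proof -
  have sN: "subspace (M \<inter> W)"
    using M W by (simp add: subspace_inter)
  obtain P where P: "Vector_Spaces.linear scale scale P" "\<And>x. P x \<in> M \<inter> W" "\<And>x. x \<in> M \<inter> W \<Longrightarrow> P x = x"
    using projection_exists[OF sN] by blast
  interpret P: Vector_Spaces.linear scale scale P by (rule P(1))
  let ?Q = "\<lambda>x y. y \<in> M \<and> P y = 0 \<and> x - y \<in> W"
  have unique: "y = y'" if "?Q x y" "?Q x y'" for x y y'
  proof -
    have "(x - y') - (x - y) \<in> W" "y - y' \<in> M"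
      using that W(1) M(1) by (blast intro: subspace_diff)+
    then have "y - y' \<in> M \<inter> W"
      by simp
    then have "P (y - y') = y - y'"
      by (rule P(3))
    then show ?thesis
      using that by (simp add: P.diff)
  qed
  have "\<exists>y. ?Q x y" if x: "x \<in> V" for x
  proof -
    obtain m where m: "m \<in> M" "x - m \<in> W"
      using sum[OF x] by blast
    have "(x - m) + P m \<in> W"
      using m(2) P(2)[of m] W(1) by (auto intro: subspace_add)
    then have "x - (m - P m) \<in> W"
      by (simp add: algebra_simps)
    moreover have "m - P m \<in> M" "P (m - P m) = 0"
      using m(1) P(2,3) M(1) by (auto simp: P.diff intro: subspace_diff)
    ultimately show ?thesis
      by blast
  qed
  then obtain q where q: "\<And>x. x \<in> V \<Longrightarrow> ?Q x (q x)"
    by metis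
  have "linear_on scale scale V V q"
    unfolding linear_on_def
  proof (intro conjI ballI allI)
    fix x y assume xy: "x \<in> V" "y \<in> V"
    have "(x + y) - (q x + q y) = (x - q x) + (y - q y)"
      by simp
    also have "\<dots> \<in> W"
      using q[OF xy(1)] q[OF xy(2)] W(1) by (auto intro: subspace_add)
    finally have "?Q (x + y) (q x + q y)"
      using q[OF xy(1)] q[OF xy(2)] M(1) by (auto simp: P.add intro: subspace_add)
    then show "q (x + y) = q x + q y"
      using unique q xy by blast
  next
    fix c x assume x: "x \<in> V"
    have "scale c (x - q x) \<in> W" "scale c (q x) \<in> M"
      using q[OF x] W(1) M(1) by (auto intro: subspace_scale)
    then have "?Q (scale c x) (scale c (q x))"
      using q[OF x] by (auto simp: P.scale scale_right_diff_distrib)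
    then show "q (scale c x) = scale c (q x)"
      using unique q x by blast
  qed (use q M(2) in blast)
  moreover have "q x = 0" if x: "x \<in> W" for x
  proof -
    have "?Q x 0"
      using x subspace_0[OF M(1)] by simp
    then show ?thesis
      using unique q x W(2) by blast
  qed
  ultimately show thesis
    using q that by blast
qed

text \<open>
  A minimal invariant \<open>I\<close> and a vector \<open>l\<close> outside \<open>I\<^sup>\<bottom>\<close> produce the cyclic space \<open>M\<close> of \<open>l\<close>. The
  invariant subspace \<open>I \<inter> M\<^sup>\<bottom>\<close> of \<open>I\<close> is proper because \<open>l \<in> M\<close>, so it is zero, and dually
  \<open>M + I\<^sup>\<bottom>\<close> is everything.
\<close>

lemma dual_cyclic_subspace_exists:
  assumes I: "invariant I" "I \<noteq> {0}" and min: "\<And>J. \<lbrakk>invariant J; J \<subset> I\<rbrakk> \<Longrightarrow> J = {0}"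
  obtains M where "invariant M" "\<And>x y. \<lbrakk>x \<in> M; y \<in> M\<rbrakk> \<Longrightarrow> \<omega> x y = 0"
    "\<And>x. x \<in> V \<Longrightarrow> \<exists>m\<in>M. x - m \<in> I\<^sup>\<bottom>"
proof -
  have IV: "subspace I" "I \<subseteq> V"
    using I(1) by (auto simp: invariant_def)
  obtain i l where il: "i \<in> I" "l \<in> V" "\<omega> i l \<noteq> 0"
    using form_nondeg IV(2) I(2) subspace_0[OF IV(1)] by blast
  let ?M = "cyclic_subspace l"
  have M: "subspace ?M" "?M \<subseteq> V"
    using cyclic_subspace(2)[OF il(2)] by (auto simp: invariant_def)
  have "I \<inter> ?M\<^sup>\<bottom> = {0}"
  proof (rule min)
    show "invariant (I \<inter> ?M\<^sup>\<bottom>)"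
      using I(1) cyclic_subspace(2)[OF il(2)] by (intro invariant_Int invariant_orthogonal)
    show "I \<inter> ?M\<^sup>\<bottom> \<subset> I"
      using il cyclic_subspace(1)[OF il(2)] by (auto simp: orthogonal_on_def)
  qed
  have "\<exists>m\<in>?M. x - m \<in> I\<^sup>\<bottom>" if x: "x \<in> V" for x
  proof -
    have "?M\<^sup>\<bottom> \<inter> (I\<^sup>\<bottom>)\<^sup>\<bottom> \<subseteq> {0}"
      using \<open>I \<inter> ?M\<^sup>\<bottom> = {0}\<close> orthogonal_orthogonal[OF IV] by blast
    then obtain m where "m \<in> ?M" "x - m \<in> I\<^sup>\<bottom>"
      by (rule sum_eq_V_if_orthogonals_disjoint
          [OF M subspace_orthogonal[OF IV(2)] orthogonal_subset x])
    then show ?thesis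
      by blast
  qed
  then show thesis
    using cyclic_subspace(2,3)[OF il(2)] that by blast
qed

end

section \<open>The double extension determined by a splitting\<close>

text \<open>
  \<open>I\<close> becomes the summand dual to the commutative algebra, and \<open>q\<close> projects along \<open>I\<^sup>\<bottom>\<close> onto a
  complement of \<open>I\<^sup>\<bottom>\<close> that carries this algebra. Asking that the complement lie in an isotropic
  left ideal \<open>M\<close> makes the component of its products in \<open>I\<close> vanish.
\<close>

locale isotropic_splitting = pre_symplectic_algebra +
  fixes I M :: "'b set" and q :: "'b \<Rightarrow> 'b"
  assumes invariant_I: "invariant I"
    and I_left_kernel: "I \<subseteq> left_kernel"
    and I_orthogonal: "I \<subseteq> left_kernel\<^sup>\<bottom>"
    and invariant_M: "invariant M"
    and isotropic_M: "\<And>x y. \<lbrakk>x \<in> M; y \<in> M\<rbrakk> \<Longrightarrow> \<omega> x y = 0"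
    and q_linear: "linear_on scale scale V V q"
    and q_M: "\<And>x. x \<in> V \<Longrightarrow> q x \<in> M"
    and q_complement: "\<And>x. x \<in> V \<Longrightarrow> x - q x \<in> I\<^sup>\<bottom>"
    and q_orthogonal: "\<And>x. x \<in> I\<^sup>\<bottom> \<Longrightarrow> q x = 0"
begin

abbreviation "W \<equiv> I\<^sup>\<bottom>"

lemma I_V: "i \<in> I \<Longrightarrow> i \<in> V"
  using invariant_I by (auto simp: invariant_def)

lemma subspace_I: "subspace I"
  using invariant_I by (simp add: invariant_def)

lemma W_V: "w \<in> W \<Longrightarrow> w \<in> V"
  by (rule orthogonalD)

lemma subspace_W: "subspace W"
  using I_V by (intro subspace_orthogonal) auto

lemma orthogonal_W: "W\<^sup>\<bottom> = I"
  using I_V by (intro orthogonal_orthogonal subspace_I) auto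

lemma left_kernel_subset_W: "left_kernel \<subseteq> W"
  using orthogonal_orthogonal[of left_kernel] orthogonal_antimono[OF I_orthogonal]
    invariant_left_kernel by (auto simp: invariant_def)

lemma I_subset_W: "I \<subseteq> W"
  using I_left_kernel left_kernel_subset_W by blast

lemma I_mul: "\<lbrakk>i \<in> I; x \<in> V\<rbrakk> \<Longrightarrow> i \<cdot> x = 0"
  using I_left_kernel by (auto simp: left_kernel_def)

lemma mul_I: "\<lbrakk>x \<in> V; i \<in> I\<rbrakk> \<Longrightarrow> x \<cdot> i \<in> I"
  using invariant_I by (auto simp: invariant_def)

lemma mul_W: "\<lbrakk>x \<in> V; w \<in> W\<rbrakk> \<Longrightarrow> x \<cdot> w \<in> W"
  using invariant_orthogonal[OF invariant_I] by (auto simp: invariant_def)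

lemma W_mul:
  assumes "w \<in> W" "x \<in> V"
  shows "w \<cdot> x \<in> W"
proof -
  have "w \<cdot> x - x \<cdot> w \<in> W"
    using assms bracket_in_left_kernel left_kernel_subset_W W_V by blast
  then have "(w \<cdot> x - x \<cdot> w) + x \<cdot> w \<in> W"
    using assms by (intro subspace_add subspace_W mul_W)
  then show ?thesis
    by simp
qed

text \<open>This is adjoint to \<open>I\<^sup>\<bottom>\<close> being a right ideal.\<close>

lemma W_mul_I:
  assumes "w \<in> W" "i \<in> I"
  shows "w \<cdot> i = 0"
proof (rule form_nondeg)
  fix x assume x: "x \<in> V"
  have "\<omega> (w \<cdot> x) i = 0"
    using W_mul[OF assms(1) x] assms(2) by (rule orthogonalD)
  then show "\<omega> (w \<cdot> i) x = 0"
    using assms x form_skew[of i "w \<cdot> x"] by (simp add: left_mul_adjoint W_V I_V)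
qed (use assms in \<open>auto simp: W_V I_V\<close>)

lemma W_I_form:
  assumes "w \<in> W" "i \<in> I"
  shows "\<omega> w i = 0" "\<omega> i w = 0"
  using assms form_skew[of i w] by (auto simp: W_V I_V orthogonalD(2))

subsection \<open>The three projections\<close>

text \<open>
  The adjoint \<open>p\<close> of the projection \<open>q\<close> projects onto \<open>I\<close>, because \<open>q\<close> has kernel \<open>I\<^sup>\<bottom>\<close>. The range
  of \<open>q\<close> is isotropic, so \<open>p q = 0\<close>, and \<open>r = 1 - p - q\<close> is a self-adjoint projection.
\<close>

definition p :: "'b \<Rightarrow> 'b" where "p = adjoint_on V \<omega> q"
definition r :: "'b \<Rightarrow> 'b" where "r x = x - p x - q x"
definition H :: "'b set" where "H = {x\<in>V. q x = x}"
definition B :: "'b set" where "B = {x\<in>V. p x = 0 \<and> q x = 0}"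

lemma q_V [simp]: "x \<in> V \<Longrightarrow> q x \<in> V"
  using q_linear by (simp add: linear_on_def)

lemma q_add: "\<lbrakk>x \<in> V; y \<in> V\<rbrakk> \<Longrightarrow> q (x + y) = q x + q y"
  and q_scale: "x \<in> V \<Longrightarrow> q (scale c x) = scale c (q x)"
  using q_linear by (auto simp: linear_on_def)

lemma q_diff: "\<lbrakk>x \<in> V; y \<in> V\<rbrakk> \<Longrightarrow> q (x - y) = q x - q y"
  using q_add[of "x - y" y] by simp

lemma q_q [simp]: "x \<in> V \<Longrightarrow> q (q x) = q x"
  using q_orthogonal[OF q_complement, of x] by (simp add: q_diff)

lemma q_isotropic [simp]: "\<lbrakk>x \<in> V; y \<in> V\<rbrakk> \<Longrightarrow> \<omega> (q x) (q y) = 0"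
  by (simp add: isotropic_M q_M)

lemma q_I [simp]: "i \<in> I \<Longrightarrow> q i = 0"
  using I_subset_W q_orthogonal by blast

lemma p_V [simp]: "x \<in> V \<Longrightarrow> p x \<in> V"
  and p_form_left: "\<lbrakk>x \<in> V; y \<in> V\<rbrakk> \<Longrightarrow> \<omega> (p x) y = \<omega> x (q y)"
proof -
  note adj = adjoint_on_works[OF fin_dim_V nondeg_form q_linear]
  show 1: "p x \<in> V" if "x \<in> V" for x
    using adj(1)[OF that] by (simp add: p_def)
  show "\<omega> (p x) y = \<omega> x (q y)" if "x \<in> V" "y \<in> V"
    using adj(2)[OF that] form_skew[of x "q y"] form_skew[of "p x" y] 1[OF that(1)] that
    by (simp add: p_def)
qed

lemma p_in_I [simp]:
  assumes "x \<in> V"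
  shows "p x \<in> I"
proof -
  have "p x \<in> W\<^sup>\<bottom>"
    using assms by (auto simp: orthogonal_on_def[of V \<omega> W] p_form_left W_V q_orthogonal)
  then show ?thesis
    by (simp add: orthogonal_W)
qed

lemma form_eqI:
  assumes "x \<in> V" "y \<in> V" "\<And>z. z \<in> V \<Longrightarrow> \<omega> x z = \<omega> y z"
  shows "x = y"
  using form_nondeg[of "x - y"] assms by (simp add: form_diff)

lemma p_add: "\<lbrakk>x \<in> V; y \<in> V\<rbrakk> \<Longrightarrow> p (x + y) = p x + p y"
  by (rule form_eqI) (simp_all add: form_add p_form_left)

lemma p_scale: "x \<in> V \<Longrightarrow> p (scale c x) = scale c (p x)"
  by (rule form_eqI) (simp_all add: form_scale p_form_left)

lemma p_diff: "\<lbrakk>x \<in> V; y \<in> V\<rbrakk> \<Longrightarrow> p (x - y) = p x - p y"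
  using p_add[of "x - y" y] by simp

lemma p_I [simp]:
  assumes "i \<in> I"
  shows "p i = i"
proof (rule form_eqI)
  fix y assume y: "y \<in> V"
  have "\<omega> i (y - q y) = 0"
    using assms y q_complement by (intro W_I_form(2)) auto
  then show "\<omega> (p i) y = \<omega> i y"
    using assms y by (simp add: p_form_left form_diff I_V)
qed (use assms in \<open>simp_all add: I_V\<close>)

lemma p_q [simp]: "x \<in> V \<Longrightarrow> p (q x) = 0"
  by (rule form_eqI) (simp_all add: p_form_left)

lemma r_V [simp]: "x \<in> V \<Longrightarrow> r x \<in> V"
  by (simp add: r_def)

lemma r_add: "\<lbrakk>x \<in> V; y \<in> V\<rbrakk> \<Longrightarrow> r (x + y) = r x + r y"
  by (simp add: r_def p_add q_add algebra_simps)

lemma r_scale: "x \<in> V \<Longrightarrow> r (scale c x) = scale c (r x)"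
  by (simp add: r_def p_scale q_scale scale_right_diff_distrib)

lemma r_diff: "\<lbrakk>x \<in> V; y \<in> V\<rbrakk> \<Longrightarrow> r (x - y) = r x - r y"
  by (simp add: r_def p_diff q_diff algebra_simps)

lemma r_0 [simp]: "r 0 = 0"
  using r_diff[of 0 0] by simp

lemma q_0 [simp]: "q 0 = 0"
  using q_diff[of 0 0] by simp

lemma p_0 [simp]: "p 0 = 0"
  using p_diff[of 0 0] by simp

lemma subspace_H: "subspace H"
  by (rule subspaceI) (auto simp: H_def q_add q_scale)

lemma subspace_B: "subspace B"
  by (rule subspaceI) (auto simp: B_def q_add q_scale p_add p_scale)

lemma decompose: "x = q x + r x + p x"
  by (simp add: r_def)

lemma r_B [simp]: "x \<in> V \<Longrightarrow> r x \<in> B"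
  by (simp add: B_def r_def p_diff q_diff)

lemma q_H [simp]: "x \<in> V \<Longrightarrow> q x \<in> H"
  by (simp add: H_def)

lemma B_V [simp]: "u \<in> B \<Longrightarrow> u \<in> V"
  by (simp add: B_def)

lemma H_V [simp]: "a \<in> H \<Longrightarrow> a \<in> V"
  by (simp add: H_def)

lemma q_on_H [simp]: "a \<in> H \<Longrightarrow> q a = a"
  unfolding H_def by blast

lemma pq_on_B [simp]: "u \<in> B \<Longrightarrow> p u = 0" "u \<in> B \<Longrightarrow> q u = 0"
  unfolding B_def by blast+

lemma r_on_B [simp]: "u \<in> B \<Longrightarrow> r u = u"
  by (simp add: r_def)

lemma p_on_H [simp]: "a \<in> H \<Longrightarrow> p a = 0"
  using p_q[of a] by simp

lemma r_on_H [simp]: "a \<in> H \<Longrightarrow> r a = 0"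
  by (simp add: r_def)

lemma r_I [simp]: "i \<in> I \<Longrightarrow> r i = 0"
  by (simp add: r_def)

lemma B_W [simp]: "u \<in> B \<Longrightarrow> u \<in> W"
  using q_complement[of u] by simp

lemma r_on_W: "w \<in> W \<Longrightarrow> r w = w - p w"
  by (simp add: r_def q_orthogonal)

lemma H_M: "a \<in> H \<Longrightarrow> a \<in> M"
  using q_M[of a] by simp

lemma form_B_H: "\<lbrakk>u \<in> B; a \<in> H\<rbrakk> \<Longrightarrow> \<omega> u a = 0" "\<lbrakk>u \<in> B; a \<in> H\<rbrakk> \<Longrightarrow> \<omega> a u = 0"
  using p_form_left[of u a] form_skew[of a u] by simp_all

lemma form_r_B: "\<lbrakk>x \<in> V; u \<in> B\<rbrakk> \<Longrightarrow> \<omega> (r x) u = \<omega> x u"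
  by (simp add: r_def form_diff p_form_left form_B_H)

lemma form_B_r: "\<lbrakk>x \<in> V; u \<in> B\<rbrakk> \<Longrightarrow> \<omega> u (r x) = \<omega> u x"
  using form_r_B[of x u] form_skew[of u "r x"] form_skew[of u x] by simp

lemma form_r_r:
  assumes "x \<in> W" "y \<in> W"
  shows "\<omega> (r x) (r y) = \<omega> x y"
proof -
  have "\<omega> (r x) (r y) = \<omega> x (r y)"
    using assms by (intro form_r_B) (simp_all add: W_V)
  then show ?thesis
    using assms W_I_form(1)[of x "p y"] by (simp add: W_V r_on_W[of y] form_diff)
qed

lemma mul_r_W: "\<lbrakk>x \<in> V; w \<in> W\<rbrakk> \<Longrightarrow> r (x \<cdot> r w) = r (x \<cdot> w)"
  by (simp add: r_on_W W_V prod_diff r_diff mul_I)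

lemma r_W_mul: "\<lbrakk>w \<in> W; x \<in> V\<rbrakk> \<Longrightarrow> r w \<cdot> x = w \<cdot> x"
  by (simp add: r_on_W W_V prod_diff I_mul)

lemma W_mul_r: "\<lbrakk>w \<in> W; x \<in> V\<rbrakk> \<Longrightarrow> w \<cdot> r x = w \<cdot> x - w \<cdot> q x"
  by (simp add: r_def W_V prod_diff W_mul_I)

lemma mul_q: "\<lbrakk>x \<in> V; y \<in> V\<rbrakk> \<Longrightarrow> r (x \<cdot> q y) = r (x \<cdot> y) - r (x \<cdot> r y)"
  by (simp add: r_def[of y] prod_diff r_diff mul_I)

lemma r_bracket_mul: "\<lbrakk>x \<in> V; y \<in> V; z \<in> V\<rbrakk> \<Longrightarrow> (r (x \<cdot> y) - r (y \<cdot> x)) \<cdot> z = 0"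
  using r_W_mul[of "x \<cdot> y - y \<cdot> x" z] bracket_in_left_kernel[of x y] left_kernel_subset_W
    bracket_mul_zero[of x y z] by (auto simp flip: r_diff)

text \<open>
  The reason for choosing the complement inside \<open>M\<close>: this is the vanishing of the component \<open>L\<close> of
  the double extension.
\<close>

lemma form_mul_H: "\<lbrakk>x \<in> V; a \<in> H; b \<in> H\<rbrakk> \<Longrightarrow> \<omega> (x \<cdot> a) b = 0"
  using invariant_M H_M[of a] H_M[of b] by (simp add: invariant_def isotropic_M)

subsection \<open>The reduced algebra and the commutative quotient\<close>

text \<open>
  Models of \<open>I\<^sup>\<bottom> / I\<close> and \<open>V / I\<^sup>\<bottom>\<close> on the complements \<open>B\<close> of \<open>I\<close> in \<open>I\<^sup>\<bottom>\<close> and \<open>H\<close> of \<open>I\<^sup>\<bottom>\<close>.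
\<close>

definition reduced :: "('b, 'a) form_alg" where
  "reduced = \<lparr>carrier = B, mul = (\<lambda>u v. r (u \<cdot> v)), form = \<omega>\<rparr>"

definition quotient :: "'b alg" where
  "quotient = \<lparr>carrier = H, mul = (\<lambda>a b. q (a \<cdot> b))\<rparr>"

lemma reduced_simps [simp]:
  "carrier reduced = B" "mul reduced = (\<lambda>u v. r (u \<cdot> v))" "form reduced = \<omega>"
  by (simp_all add: reduced_def)

lemma quotient_simps [simp]:
  "carrier quotient = H" "mul quotient = (\<lambda>a b. q (a \<cdot> b))"
  by (simp_all add: quotient_def)

lemma B_closed [simp]:
  "\<lbrakk>u \<in> B; v \<in> B\<rbrakk> \<Longrightarrow> u + v \<in> B" "u \<in> B \<Longrightarrow> scale c u \<in> B"
  "\<lbrakk>u \<in> B; v \<in> B\<rbrakk> \<Longrightarrow> u - v \<in> B" "u \<in> B \<Longrightarrow> - u \<in> B"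
  using subspace_B subspace_add subspace_scale subspace_diff subspace_neg by blast+

lemma H_closed [simp]:
  "\<lbrakk>a \<in> H; b \<in> H\<rbrakk> \<Longrightarrow> a + b \<in> H" "a \<in> H \<Longrightarrow> scale c a \<in> H"
  using subspace_H subspace_add subspace_scale by blast+

lemma fin_dim_B: "fin_dim_subspace scale B"
  by (rule fin_dim_subspace_mono[OF fin_dim_V subspace_B]) auto

lemma fin_dim_H: "fin_dim_subspace scale H"
  by (rule fin_dim_subspace_mono[OF fin_dim_V subspace_H]) auto

lemma reduced_nondeg: "nondeg_skew_form scale B \<omega>"
  unfolding nondeg_skew_form_def
proof (intro conjI ballI impI)
  show "bilinear_on scale scale (*) B B UNIV \<omega>"
    by (simp add: bilinear_on_def linear_on_def form_add form_scale)
  show "\<omega> u v = - \<omega> v u" if "u \<in> B" "v \<in> B" for u v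
    using that by (intro form_skew) auto
  fix u assume u: "u \<in> B" "\<forall>v\<in>B. \<omega> u v = 0"
  have "\<omega> u x = 0" if x: "x \<in> V" for x
    using form_B_r[OF x u(1)] u(2) r_B[OF x] by simp
  then show "u = 0"
    using u(1) by (intro form_nondeg) simp_all
qed

lemma B_eqI:
  assumes "x \<in> B" "y \<in> B" "\<And>u. u \<in> B \<Longrightarrow> \<omega> u x = \<omega> u y"
  shows "x = y"
proof -
  have "\<omega> (x - y) u = 0" if "u \<in> B" for u
    using assms that form_skew[of x u] form_skew[of y u] by (simp add: form_diff)
  then have "x - y = 0"
    using reduced_nondeg assms(1,2) unfolding nondeg_skew_form_def by (metis B_closed(3))
  then show ?thesis
    by simp
qed

lemma reduced_pre_symplectic: "pre_symplectic_lsa scale reduced"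
  unfolding pre_symplectic_lsa_def left_symmetric_alg_def is_alg_def
proof (intro conjI ballI)
  show "bilinear_on scale scale scale (carrier reduced) (carrier reduced) (carrier reduced) (mul reduced)"
    by (simp add: bilinear_on_def linear_on_def prod_add prod_scale r_add r_scale)
  show "left_mul_symmetric reduced"
    by (simp add: left_mul_symmetric_def form_r_B form_B_r left_mul_adjoint)
  fix u v w assume "u \<in> carrier reduced" "v \<in> carrier reduced" "w \<in> carrier reduced"
  then show "mul reduced (mul reduced u v) w - mul reduced u (mul reduced v w) =
      mul reduced (mul reduced v u) w - mul reduced v (mul reduced u w)"
    by (simp add: mul_r_W r_W_mul W_mul mul_W left_mul_commute[of u v w] prod_commute_left_factor[of u v w])
qed (simp_all add: fin_dim_B reduced_nondeg)

lemma q_mul_cong: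
  assumes "x \<in> V" "y \<in> V"
  shows "q (q x \<cdot> q y) = q (x \<cdot> y)"
proof -
  have "x \<cdot> y = q x \<cdot> q y + (q x \<cdot> (y - q y) + (x - q x) \<cdot> y)"
    using assms by (simp add: prod_diff)
  moreover have "q x \<cdot> (y - q y) + (x - q x) \<cdot> y \<in> W"
    using assms by (intro subspace_add subspace_W mul_W W_mul q_complement) auto
  ultimately show ?thesis
    using assms by (simp add: q_add q_orthogonal)
qed

lemma q_mul_commute:
  assumes "x \<in> V" "y \<in> V"
  shows "q (x \<cdot> y) = q (y \<cdot> x)"
  using q_orthogonal[of "x \<cdot> y - y \<cdot> x"] bracket_in_left_kernel[of x y] left_kernel_subset_W assms
  by (auto simp: q_diff)

lemma quotient_comm_assoc: "comm_assoc_alg scale quotient"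
  unfolding comm_assoc_alg_def is_alg_def
proof (intro conjI ballI)
  show "bilinear_on scale scale scale (carrier quotient) (carrier quotient) (carrier quotient) (mul quotient)"
    by (simp add: bilinear_on_def linear_on_def prod_add prod_scale q_add q_scale)
  show "mul quotient a b = mul quotient b a" if "a \<in> carrier quotient" "b \<in> carrier quotient" for a b
    using that by (simp add: q_mul_commute)
  fix a b c assume "a \<in> carrier quotient" "b \<in> carrier quotient" "c \<in> carrier quotient"
  then have abc: "a \<in> H" "b \<in> H" "c \<in> H"
    by simp_all
  have "q (q (a \<cdot> b) \<cdot> c) = q ((a \<cdot> b) \<cdot> c)"
    using abc q_mul_cong[of "a \<cdot> b" c] by simp
  also have "\<dots> = q (c \<cdot> (a \<cdot> b))"
    using abc by (intro q_mul_commute) auto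
  also have "\<dots> = q (a \<cdot> (c \<cdot> b))"
    using abc by (simp add: left_mul_commute[of c a b])
  also have "\<dots> = q (a \<cdot> q (c \<cdot> b))"
    using abc q_mul_cong[of a "c \<cdot> b"] by simp
  also have "\<dots> = q (a \<cdot> q (b \<cdot> c))"
    using abc by (simp add: q_mul_commute[of c b])
  finally show "mul quotient (mul quotient a b) c = mul quotient a (mul quotient b c)"
    by simp
qed (simp_all add: fin_dim_H)

subsection \<open>The structure maps\<close>

definition F :: "'b \<Rightarrow> 'b \<Rightarrow> 'b" where "F a u = r (a \<cdot> u)"
definition G :: "'b \<Rightarrow> 'b \<Rightarrow> 'b" where "G a u = r (u \<cdot> a)"
definition \<theta> :: "'b \<Rightarrow> 'b \<Rightarrow> 'b" where "\<theta> a b = r (a \<cdot> b)"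

text \<open>
  \<open>\<Omega> a b\<close> is the vector of \<open>B\<close> representing \<open>u \<mapsto> \<omega> (u \<cdot> a) b\<close>; the sign comes from moving the
  adjoint of \<open>R\<^sub>a\<close> to the left argument of the skew form.
\<close>

definition \<Omega> :: "'b \<Rightarrow> 'b \<Rightarrow> 'b" where "\<Omega> a b = - r (adjoint_on V \<omega> (\<lambda>x. x \<cdot> a) b)"

lemma \<Omega>_B [simp]: "\<lbrakk>a \<in> V; b \<in> V\<rbrakk> \<Longrightarrow> \<Omega> a b \<in> B"
  and form_\<Omega>_right: "\<lbrakk>a \<in> V; b \<in> V; u \<in> B\<rbrakk> \<Longrightarrow> \<omega> u (\<Omega> a b) = - \<omega> (u \<cdot> a) b"
proof -
  let ?adj = "adjoint_on V \<omega> (\<lambda>x. x \<cdot> a)"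
  assume ab: "a \<in> V" "b \<in> V"
  have "linear_on scale scale V V (\<lambda>x. x \<cdot> a)"
    using ab by (simp add: linear_on_def prod_add prod_scale)
  note adj = adjoint_on_works[OF fin_dim_V nondeg_form this ab(2)]
  show "\<Omega> a b \<in> B"
    using adj(1) by (simp add: \<Omega>_def)
  show "\<omega> u (\<Omega> a b) = - \<omega> (u \<cdot> a) b" if "u \<in> B"
    using form_scale(2)[of u "r (?adj b)" "-1"] adj(1) adj(2)[of u] that
    by (simp add: \<Omega>_def form_B_r)
qed

lemma form_\<Omega>_left: "\<lbrakk>a \<in> V; b \<in> V; u \<in> B\<rbrakk> \<Longrightarrow> \<omega> (\<Omega> a b) u = \<omega> (u \<cdot> a) b"
  using form_skew[of "\<Omega> a b" u] by (simp add: form_\<Omega>_right)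

lemma mul_form_skew:
  "\<lbrakk>x \<in> V; y \<in> V; z \<in> V\<rbrakk> \<Longrightarrow> \<omega> (x \<cdot> y) z = - \<omega> (x \<cdot> z) y"
  using form_skew[of y "x \<cdot> z"] by (simp add: left_mul_adjoint)

lemma adjoint_G:
  assumes "a \<in> H" "y \<in> B"
  shows "adjoint_on B \<omega> (G a) y \<in> B"
    and "u \<in> B \<Longrightarrow> \<omega> u (adjoint_on B \<omega> (G a) y) = \<omega> (G a u) y"
proof -
  have lin: "linear_on scale scale B B (G a)"
    using assms by (simp add: linear_on_def G_def prod_add prod_scale r_add r_scale)
  show "adjoint_on B \<omega> (G a) y \<in> B"
    and "u \<in> B \<Longrightarrow> \<omega> u (adjoint_on B \<omega> (G a) y) = \<omega> (G a u) y"
    using adjoint_on_works[OF fin_dim_B reduced_nondeg lin assms(2)] by auto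
qed

lemma FG_B [simp]:
  "\<lbrakk>a \<in> H; u \<in> B\<rbrakk> \<Longrightarrow> F a u \<in> B" "\<lbrakk>a \<in> H; u \<in> B\<rbrakk> \<Longrightarrow> G a u \<in> B"
  "\<lbrakk>a \<in> H; b \<in> H\<rbrakk> \<Longrightarrow> \<theta> a b \<in> B"
  by (simp_all add: F_def G_def \<theta>_def)

lemma form_neg_right: "\<lbrakk>x \<in> V; y \<in> V\<rbrakk> \<Longrightarrow> \<omega> x (- y) = - \<omega> x y"
  using form_scale(2)[of x y "-1"] by simp

lemma F_G_eq: "\<lbrakk>a \<in> H; b \<in> H; u \<in> B\<rbrakk> \<Longrightarrow> F a (G b u) = G (q (a \<cdot> b)) u + r (u \<cdot> \<theta> a b)"
  by (simp add: F_def G_def \<theta>_def mul_r_W W_mul W_mul_r r_diff left_mul_commute[of a u b])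

lemma theta_cocycle:
  "\<lbrakk>a \<in> H; b \<in> H; c \<in> H\<rbrakk> \<Longrightarrow>
    \<theta> a (q (b \<cdot> c)) - \<theta> b (q (a \<cdot> c)) = F b (\<theta> a c) - F a (\<theta> b c)"
  by (simp add: F_def \<theta>_def mul_q left_mul_commute[of a b c])

text \<open>
  The three identities for adjoints of \<open>G\<close> are tested against a vector \<open>v\<close> of \<open>B\<close>. There they
  reduce to identities between values of \<open>\<omega>\<close> that follow from the commutation of left
  multiplications and \<open>(a \<cdot> v) \<cdot> b = (v \<cdot> a) \<cdot> b\<close>.
\<close>

lemma adjoint_G_G_skew:
  assumes "a \<in> H" "b \<in> H" "u \<in> B"
  shows "adjoint_on B \<omega> (G a) (G b u) = - adjoint_on B \<omega> (G b) (G a u)"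
proof (rule B_eqI)
  fix v assume v: "v \<in> B"
  have V: "a \<in> V" "b \<in> V" "u \<in> V" "v \<in> V"
    using assms v by simp_all
  have GG: "\<omega> (G c v) (G d u) = \<omega> (v \<cdot> c) (u \<cdot> d)" if "c \<in> H" "d \<in> H" for c d
    using that assms v by (simp add: G_def form_r_r W_mul)
  have "\<omega> (v \<cdot> a) (u \<cdot> b) = - \<omega> (v \<cdot> (u \<cdot> b)) a"
    using V by (intro mul_form_skew) auto
  also have "\<dots> = - \<omega> (u \<cdot> (v \<cdot> b)) a"
    using V by (simp add: left_mul_commute[of v u b])
  also have "\<dots> = - \<omega> (v \<cdot> b) (u \<cdot> a)"
    using V by (simp add: left_mul_adjoint[of u])
  finally show "\<omega> v (adjoint_on B \<omega> (G a) (G b u)) = \<omega> v (- adjoint_on B \<omega> (G b) (G a u))"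
    using assms v by (simp add: adjoint_G form_neg_right GG)
qed (use assms in \<open>simp_all add: adjoint_G\<close>)

lemma adjoint_G_Omega:
  assumes "a \<in> H" "b \<in> H" "c \<in> H"
  shows "adjoint_on B \<omega> (G a) (\<Omega> b c) = F a (\<Omega> b c)"
proof (rule B_eqI)
  fix v assume v: "v \<in> B"
  have "\<omega> v (F a (\<Omega> b c)) = \<omega> (F a v) (\<Omega> b c)"
    using assms v by (simp add: F_def form_B_r form_r_B left_mul_adjoint)
  also have "\<dots> = - \<omega> ((a \<cdot> v) \<cdot> b) c"
    using assms v by (simp add: form_\<Omega>_right F_def r_W_mul mul_W)
  also have "\<dots> = - \<omega> ((v \<cdot> a) \<cdot> b) c"
    using assms v by (simp add: prod_commute_left_factor[of a v b])
  also have "\<dots> = \<omega> (G a v) (\<Omega> b c)"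
    using assms v by (simp add: form_\<Omega>_right G_def r_W_mul W_mul)
  finally show "\<omega> v (adjoint_on B \<omega> (G a) (\<Omega> b c)) = \<omega> v (F a (\<Omega> b c))"
    using assms v by (simp add: adjoint_G)
qed (use assms in \<open>simp_all add: adjoint_G\<close>)

lemma adjoint_G_theta_skew:
  assumes "a \<in> H" "b \<in> H" "c \<in> H"
  shows "adjoint_on B \<omega> (G b) (\<theta> a c) + \<Omega> (q (a \<cdot> c)) b =
    - adjoint_on B \<omega> (G c) (\<theta> a b) - \<Omega> (q (a \<cdot> b)) c"
proof (rule B_eqI)
  fix v assume v: "v \<in> B"
  have half: "\<omega> v (adjoint_on B \<omega> (G d) (\<theta> a e) + \<Omega> (q (a \<cdot> e)) d) = \<omega> (v \<cdot> d) (a \<cdot> e)"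
    if "d \<in> H" "e \<in> H" for d e
  proof -
    \<comment> \<open>The term in \<open>\<Omega>\<close> supplies exactly the contribution of \<open>q (a \<cdot> e)\<close> that \<open>\<theta>\<close> misses.\<close>
    let ?x = "a \<cdot> e"
    have V: "v \<cdot> d \<in> W" "v \<cdot> d \<in> V" "?x \<in> V"
      using that assms v by (auto intro: W_mul)
    have "\<omega> (v \<cdot> d) ?x = \<omega> (v \<cdot> d) (q ?x) + \<omega> (v \<cdot> d) (r ?x) + \<omega> (v \<cdot> d) (p ?x)"
      using V by (subst decompose[of ?x]) (simp add: form_add)
    also have "\<omega> (v \<cdot> d) (p ?x) = 0"
      using V by (simp add: W_I_form)
    also have "\<omega> (v \<cdot> d) (r ?x) = \<omega> (G d v) (\<theta> a e)"
      using V by (simp add: G_def \<theta>_def form_r_B)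
    also have "\<omega> (v \<cdot> d) (q ?x) = - \<omega> (v \<cdot> q ?x) d"
      using that assms v by (intro mul_form_skew) auto
    finally show ?thesis
      using that assms v by (simp add: form_add adjoint_G form_\<Omega>_right)
  qed
  have "\<omega> (v \<cdot> b) (a \<cdot> c) = - \<omega> (v \<cdot> (a \<cdot> c)) b"
    using assms v by (intro mul_form_skew) auto
  also have "\<dots> = - \<omega> (a \<cdot> (v \<cdot> c)) b"
    using assms v by (simp add: left_mul_commute[of v a c])
  also have "\<dots> = - \<omega> (v \<cdot> c) (a \<cdot> b)"
    using assms v by (simp add: left_mul_adjoint)
  finally have "\<omega> v (adjoint_on B \<omega> (G b) (\<theta> a c) + \<Omega> (q (a \<cdot> c)) b) =
      - \<omega> v (adjoint_on B \<omega> (G c) (\<theta> a b) + \<Omega> (q (a \<cdot> b)) c)"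
    using half assms by simp
  also have "\<dots> = \<omega> v (- adjoint_on B \<omega> (G c) (\<theta> a b) - \<Omega> (q (a \<cdot> b)) c)"
    using assms v form_neg_right[of v "adjoint_on B \<omega> (G c) (\<theta> a b) + \<Omega> (q (a \<cdot> b)) c"]
    by (simp add: adjoint_G)
  finally show "\<omega> v (adjoint_on B \<omega> (G b) (\<theta> a c) + \<Omega> (q (a \<cdot> c)) b) =
      \<omega> v (- adjoint_on B \<omega> (G c) (\<theta> a b) - \<Omega> (q (a \<cdot> b)) c)" .
qed (use assms in \<open>simp_all add: adjoint_G\<close>)

lemma \<Omega>_bilinear: "bilinear_on scale scale scale H H B \<Omega>"
  unfolding bilinear_on_def linear_on_def
  by (intro conjI ballI allI)
    (auto intro!: B_eqI simp: form_add form_scale form_\<Omega>_right prod_add prod_scale algebra_simps)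

lemma \<Omega>_skew: "\<lbrakk>a \<in> H; b \<in> H\<rbrakk> \<Longrightarrow> \<Omega> a b = - \<Omega> b a"
  by (rule B_eqI) (simp_all add: form_neg_right form_\<Omega>_right mul_form_skew[of _ a b])

lemma double_extension_data: "double_extension_data scale reduced quotient F G \<theta> (\<lambda>a b c. 0) \<Omega>"
proof (unfold_locales, unfold reduced_simps quotient_simps)
  show "bilinear_on scale scale scale H B B F" "bilinear_on scale scale scale H B B G"
    "bilinear_on scale scale scale H H B \<theta>"
    by (simp_all add: bilinear_on_def linear_on_def F_def G_def \<theta>_def prod_add prod_scale r_add r_scale)
  show "bilinear_on scale scale fun_scale H H (dual_space scale H) (\<lambda>a b c. 0)"
    by (auto simp: bilinear_on_def linear_on_def dual_space_def fun_scale_def fun_eq_iff)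
  show "\<omega> (F a u) v = \<omega> u (F a v)" if "a \<in> H" "u \<in> B" "v \<in> B" for a u v
    using that by (simp add: F_def form_r_B form_B_r left_mul_adjoint)
  show "G a (bracket reduced u v) = 0" if "a \<in> H" "u \<in> B" "v \<in> B" for a u v
    using that by (simp add: G_def bracket_def r_bracket_mul)
  show "r (u \<cdot> G a v) = r (v \<cdot> G a u)" if "a \<in> H" "u \<in> B" "v \<in> B" for a u v
    using that by (simp add: G_def mul_r_W W_mul left_mul_commute[of u v a])
  show "r (G a u \<cdot> v) = r (F a u \<cdot> v)" if "a \<in> H" "u \<in> B" "v \<in> B" for a u v
    using that by (simp add: F_def G_def r_W_mul W_mul mul_W prod_commute_left_factor[of u a v])
  show "F a (r (u \<cdot> v)) = r (u \<cdot> F a v)" if "a \<in> H" "u \<in> B" "v \<in> B" for a u v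
    using that by (simp add: F_def mul_r_W W_mul mul_W left_mul_commute[of a u v])
  show "G b (G a u) = G b (F a u)" if "a \<in> H" "b \<in> H" "u \<in> B" for a b u
    using that by (simp add: F_def G_def r_W_mul W_mul mul_W prod_commute_left_factor[of u a b])
  show "F a (F b u) = F b (F a u)" if "a \<in> H" "b \<in> H" "u \<in> B" for a b u
    using that by (simp add: F_def mul_r_W mul_W left_mul_commute[of a b u])
  show "r (\<theta> a b \<cdot> u) = r (\<theta> b a \<cdot> u)" if "a \<in> H" "b \<in> H" "u \<in> B" for a b u
    using that r_bracket_mul[of a b u] by (simp add: \<theta>_def prod_diff)
  show "G c (\<theta> a b) = G c (\<theta> b a)" if "a \<in> H" "b \<in> H" "c \<in> H" for a b c
    using that r_bracket_mul[of a b c] by (simp add: \<theta>_def G_def prod_diff)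
  show "\<omega> (\<Omega> a b) (bracket reduced u v) = 0" if "a \<in> H" "b \<in> H" "u \<in> B" "v \<in> B" for a b u v
    using that by (simp add: bracket_def form_\<Omega>_left r_bracket_mul)
  show "\<omega> (\<Omega> c l) (\<theta> a b - \<theta> b a) = 0" if "a \<in> H" "b \<in> H" "c \<in> H" "l \<in> H" for a b c l
    using that by (simp add: \<theta>_def form_\<Omega>_left r_bracket_mul)
  show "adjoint_on B \<omega> (G a) (G b u) = - adjoint_on B \<omega> (G b) (G a u)"
    if "a \<in> H" "b \<in> H" "u \<in> B" for a b u
    using that by (rule adjoint_G_G_skew)
  show "adjoint_on B \<omega> (G b) (\<theta> a c) + \<Omega> (q (a \<cdot> c)) b =
      - adjoint_on B \<omega> (G c) (\<theta> a b) - \<Omega> (q (a \<cdot> b)) c"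
    if "a \<in> H" "b \<in> H" "c \<in> H" for a b c
    using that by (rule adjoint_G_theta_skew)
  show "\<Omega> a b = - \<Omega> b a" if "a \<in> H" "b \<in> H" for a b
    using that by (rule \<Omega>_skew)
qed (simp_all add: reduced_pre_symplectic quotient_comm_assoc \<Omega>_bilinear F_G_eq theta_cocycle adjoint_G_Omega)

subsection \<open>The isomorphism\<close>

text \<open>
  The third component restricts \<open>\<omega> x\<close> to \<open>H\<close>. It only sees \<open>p x\<close>, as \<open>H\<close> is isotropic and
  orthogonal to \<open>B\<close>, and it identifies \<open>I\<close> with the dual of \<open>H\<close>.
\<close>

definition \<phi> :: "'b \<Rightarrow> 'b \<times> 'b \<times> ('b \<Rightarrow> 'a)" where
  "\<phi> x = (q x, r x, \<lambda>c. if c \<in> H then \<omega> x c else 0)"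

lemma \<phi>_dual: "x \<in> V \<Longrightarrow> (\<lambda>c. if c \<in> H then \<omega> x c else 0) \<in> dual_space scale H"
  by (auto simp: dual_space_def linear_on_def form_add form_scale)

lemma \<phi>_bij: "bij_betw \<phi> V (H \<times> B \<times> dual_space scale H)"
  unfolding bij_betw_def
proof
  have "x = 0" if x: "x \<in> V" "q x = 0" "r x = 0" "\<And>c. c \<in> H \<Longrightarrow> \<omega> x c = 0" for x
  proof (rule form_nondeg[OF x(1)])
    fix y assume y: "y \<in> V"
    have "x = p x"
      using decompose[of x] x(2,3) by simp
    then have "\<omega> x y = \<omega> x (q y)"
      using p_form_left[OF x(1) y] by simp
    then show "\<omega> x y = 0"
      using x(4) y by simp
  qed
  note inj = this
  show "inj_on \<phi> V"
  proof (rule inj_onI)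
    fix x y assume xy: "x \<in> V" "y \<in> V" "\<phi> x = \<phi> y"
    then have eq: "q x = q y" "r x = r y"
      and f: "(\<lambda>c. if c \<in> H then \<omega> x c else 0) = (\<lambda>c. if c \<in> H then \<omega> y c else 0)"
      by (simp_all add: \<phi>_def)
    have "x - y = 0"
    proof (rule inj)
      show "\<omega> (x - y) c = 0" if "c \<in> H" for c
        using fun_cong[OF f, of c] xy(1,2) that by (simp add: form_diff)
    qed (use xy(1,2) eq in \<open>simp_all add: q_diff r_diff\<close>)
    then show "x = y"
      by simp
  qed
  show "\<phi> ` V = H \<times> B \<times> dual_space scale H"
  proof (intro equalityI subsetI)
    fix t assume "t \<in> \<phi> ` V"
    then show "t \<in> H \<times> B \<times> dual_space scale H"
      by (auto simp: \<phi>_def \<phi>_dual)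
  next
    fix t assume "t \<in> H \<times> B \<times> dual_space scale H"
    then obtain a u f where t: "t = (a, u, f)" "a \<in> H" "u \<in> B" "f \<in> dual_space scale H"
      by blast
    \<comment> \<open>Extend \<open>f\<close> by zero along \<open>W\<close>; the vector representing the extension lies in \<open>W\<^sup>\<bottom> = I\<close>.\<close>
    have "linear_on scale (*) V UNIV (\<lambda>x. f (q x))"
      using t(4) by (simp add: linear_on_def dual_space_def q_add q_scale)
    then obtain i where i: "i \<in> V" "\<And>x. x \<in> V \<Longrightarrow> \<omega> i x = f (q x)"
      using riesz_representation[OF fin_dim_V nondeg_form] by blast
    have "f 0 = 0"
      using t(4) linear_on_zero[OF subspace_H, of "(*)" UNIV f]
      by (simp add: dual_space_def vector_space_def algebra_simps)
    then have "i \<in> W\<^sup>\<bottom>"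
      using i by (auto simp: orthogonal_on_def[of V \<omega> W] W_V q_orthogonal)
    then have iI: "i \<in> I"
      by (simp add: orthogonal_W)
    have fc: "\<omega> (a + u + i) c = f c" if "c \<in> H" for c
      using t that i q_isotropic[of a c] by (simp add: form_add form_B_H)
    have "\<phi> (a + u + i) = t"
      using t i iI fc unfolding \<phi>_def
      by (auto simp: q_add r_add dual_space_def fun_eq_iff)
    moreover have "a + u + i \<in> V"
      using t i by simp
    ultimately show "t \<in> \<phi> ` V"
      by blast
  qed
qed

lemma \<phi>_form:
  assumes "x \<in> V" "y \<in> V"
  shows "\<omega> (r x) (r y) + \<omega> x (q y) - \<omega> y (q x) = \<omega> x y"
proof -
  have "\<omega> (r x) (r y) = \<omega> x (r y)"
    using assms by (simp add: form_r_B)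
  also have "\<dots> = \<omega> x y - \<omega> x (p y) - \<omega> x (q y)"
    using assms by (simp add: r_def[of y] form_diff)
  also have "\<omega> x (p y) = - \<omega> y (q x)"
    using assms form_skew[of x "p y"] by (simp add: p_form_left)
  finally show ?thesis
    by simp
qed

text \<open>
  Only \<open>q x + r x\<close> acts from the left, and of its summands only \<open>q x\<close> acts on \<open>I\<close>. The functional
  component of \<open>q x \<cdot> y\<close> is computed by moving \<open>q x\<close> across the form; the term in \<open>L\<close> drops out.
\<close>

lemma \<phi>_mul:
  assumes x: "x \<in> V" and y: "y \<in> V"
  shows "r (x \<cdot> y) = r (r x \<cdot> r y) + G (q y) (r x) + F (q x) (r y) + \<theta> (q x) (q y)"
    and "c \<in> H \<Longrightarrow> \<omega> (x \<cdot> y) c =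
      - \<omega> (G c (r x)) (r y) + \<omega> (\<Omega> (q y) c) (r x) - \<omega> (\<theta> (q x) c) (r y) + \<omega> y (q (q x \<cdot> c))"
proof -
  have xy: "x \<cdot> y = (q x + r x) \<cdot> y"
    using x y by (subst decompose[of x]) (simp add: prod_add I_mul)
  have "x \<cdot> y = q x \<cdot> q y + q x \<cdot> r y + q x \<cdot> p y + (r x \<cdot> q y + r x \<cdot> r y)"
    unfolding xy using x y by (subst decompose[of y]) (simp add: prod_add W_mul_I)
  then show "r (x \<cdot> y) = r (r x \<cdot> r y) + G (q y) (r x) + F (q x) (r y) + \<theta> (q x) (q y)"
    using x y by (simp add: F_def G_def \<theta>_def r_add mul_I)
  assume c: "c \<in> H"
  have 1: "\<omega> (q x \<cdot> y) c = \<omega> y (q (q x \<cdot> c)) - \<omega> (\<theta> (q x) c) (r y)"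
  proof -
    let ?z = "q x \<cdot> c"
    have z: "?z \<in> V"
      using x c by simp
    have "\<omega> (q x \<cdot> y) c = \<omega> y ?z"
      using x y c by (simp add: left_mul_adjoint)
    also have "\<dots> = \<omega> (r y) (r ?z) + \<omega> y (q ?z) - \<omega> ?z (q y)"
      using \<phi>_form[OF y z] by simp
    also have "\<omega> ?z (q y) = 0"
      using x y c by (intro form_mul_H) simp_all
    also have "\<omega> (r y) (r ?z) = - \<omega> (\<theta> (q x) c) (r y)"
      unfolding \<theta>_def using y z by (intro form_skew) simp_all
    finally show ?thesis
      by simp
  qed
  have 2: "\<omega> (r x \<cdot> y) c = - \<omega> (G c (r x)) (r y) + \<omega> (\<Omega> (q y) c) (r x)"
  proof -
    have "\<omega> (r x \<cdot> y) c = \<omega> (r x \<cdot> q y) c + \<omega> (r x \<cdot> r y) c"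
      using x y c by (subst decompose[of y]) (simp add: prod_add W_mul_I form_add)
    also have "\<omega> (r x \<cdot> r y) c = - \<omega> (r x \<cdot> c) (r y)"
      using x y c by (intro mul_form_skew) simp_all
    also have "\<omega> (r x \<cdot> c) (r y) = \<omega> (G c (r x)) (r y)"
      using x y c by (simp add: G_def form_r_B)
    finally show ?thesis
      using x y c by (simp add: form_\<Omega>_left)
  qed
  show "\<omega> (x \<cdot> y) c = - \<omega> (G c (r x)) (r y) + \<omega> (\<Omega> (q y) c) (r x)
      - \<omega> (\<theta> (q x) c) (r y) + \<omega> y (q (q x \<cdot> c))"
    unfolding xy using x y c 1 2 by (simp add: prod_add form_add)
qed

proposition is_double_extension_reduced: "is_double_extension scale A reduced quotient"
proof -
  let ?D = "double_extension scale reduced quotient F G \<theta> (\<lambda>a b c. 0) \<Omega>"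
  have "linear_on scale (dext_scale scale) V (carrier ?D) \<phi>"
    using \<phi>_bij unfolding linear_on_def bij_betw_def
    by (auto simp: double_extension_def \<phi>_def dext_scale_def fun_scale_def fun_eq_iff \<phi>_dual
        q_add q_scale r_add r_scale form_add form_scale)
  moreover have "bij_betw \<phi> V (carrier ?D)"
    using \<phi>_bij by (simp add: double_extension_def)
  moreover have "\<phi> (x \<cdot> y) = mul ?D (\<phi> x) (\<phi> y)" if "x \<in> V" "y \<in> V" for x y
    using that \<phi>_mul[OF that]
    by (simp add: double_extension_def \<phi>_def fun_eq_iff q_mul_cong)
  moreover have "form ?D (\<phi> x) (\<phi> y) = \<omega> x y" if "x \<in> V" "y \<in> V" for x y
    using that \<phi>_form[OF that] by (simp add: double_extension_def \<phi>_def)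
  ultimately have "form_alg_iso scale (dext_scale scale) A ?D"
    unfolding form_alg_iso_def by blast
  then show ?thesis
    using double_extension_data unfolding is_double_extension_def by blast
qed

end

section \<open>Induction on the dimension\<close>

context pre_symplectic_algebra
begin

text \<open>
  Here \<open>left_kernel \<inter> left_kernel\<^sup>\<bottom>\<close> is a nonzero isotropic ideal, and the splitting is built from
  a minimal invariant subspace \<open>I\<close> of it. Since \<open>I\<close> is nonzero, so is its dual \<open>H\<close>, and \<open>B\<close> is
  a proper subspace.
\<close>

proposition double_extension_of_smaller:
  assumes "\<not> milnor_pre_symplectic scale A"
  obtains B h where "pre_symplectic_lsa scale B" "dim (carrier B) < dim V"
    "comm_assoc_alg scale h" "carrier h \<noteq> {0}" "is_double_extension scale A B h"
proof -
  let ?R = "left_kernel \<inter> left_kernel\<^sup>\<bottom>"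
  have "?R \<noteq> {0}"
    using assms milnor_if_left_kernel_nondegenerate by blast
  moreover have "invariant ?R"
    by (intro invariant_Int invariant_orthogonal invariant_left_kernel)
  ultimately obtain I where I: "invariant I" "I \<noteq> {0}" "I \<subseteq> ?R"
      "\<And>J. \<lbrakk>invariant J; J \<subset> I\<rbrakk> \<Longrightarrow> J = {0}"
    using minimal_invariant_exists[of ?R] by metis
  obtain M where M: "invariant M" "\<And>x y. \<lbrakk>x \<in> M; y \<in> M\<rbrakk> \<Longrightarrow> \<omega> x y = 0"
      "\<And>x. x \<in> V \<Longrightarrow> \<exists>m\<in>M. x - m \<in> I\<^sup>\<bottom>"
    using dual_cyclic_subspace_exists[OF I(1,2,4)] by metis
  have sub: "subspace M" "M \<subseteq> V" "subspace (I\<^sup>\<bottom>)" "I\<^sup>\<bottom> \<subseteq> V"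
    using M(1) invariant_orthogonal[OF I(1)] by (auto simp: invariant_def)
  obtain q where q: "linear_on scale scale V V q" "\<And>x. x \<in> V \<Longrightarrow> q x \<in> M"
      "\<And>x. x \<in> V \<Longrightarrow> x - q x \<in> I\<^sup>\<bottom>" "\<And>x. x \<in> I\<^sup>\<bottom> \<Longrightarrow> q x = 0"
    using projection_along[OF sub M(3)] by metis
  interpret isotropic_splitting scale A I M q
    using I(1,3) M(1,2) q by unfold_locales auto
  obtain i where i: "i \<in> I" "i \<noteq> 0"
    using I(2) subspace_0[OF subspace_I] by blast
  have "i \<notin> B"
    using i p_I[of i] pq_on_B(1)[of i] by auto
  then have "B \<subset> V"
    using I_V[OF i(1)] by auto
  then have smaller: "dim B < dim V"
    by (rule fin_dim_dim_psubset[OF fin_dim_V subspace_B])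
  have "H \<noteq> {0}"
  proof
    assume "H = {0}"
    then have "q x = 0" if "x \<in> V" for x
      using q_H[OF that] by blast
    then have "\<omega> i x = 0" if "x \<in> V" for x
      using p_form_left[OF I_V[OF i(1)] that] i(1) that I_V by simp
    then show False
      using form_nondeg I_V[OF i(1)] i(2) by blast
  qed
  then show thesis
    using that[of reduced quotient] smaller reduced_pre_symplectic quotient_comm_assoc
      is_double_extension_reduced by simp
qed

end

theorem theorem6p4:
  fixes scale :: "'k::field_char_0 \<Rightarrow> 'v::ab_group_add \<Rightarrow> 'v"
    and A :: "('v, 'k) form_alg"
  assumes "vector_space scale"
    and "pre_symplectic_lsa scale A"
  shows "milnor_pre_symplectic scale A \<or>
    (\<exists>(n::nat) (As :: nat \<Rightarrow> ('v, 'k) form_alg).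
       n \<ge> 1 \<and>
       (\<forall>k\<le>n. pre_symplectic_lsa scale (As k)) \<and>
       milnor_pre_symplectic scale (As 0) \<and>
       (\<forall>k\<in>{1..n}. \<exists>h. comm_assoc_alg scale h \<and> carrier h \<noteq> {0} \<and>
                       is_double_extension scale (As k) (As (k - 1)) h) \<and>
       As n = A)"
proof -
  interpret vector_space scale by fact
  define chain where "chain = (\<lambda>A n (As :: nat \<Rightarrow> ('v, 'k) form_alg).
       (\<forall>k\<le>n. pre_symplectic_lsa scale (As k)) \<and>
       milnor_pre_symplectic scale (As 0) \<and>
       (\<forall>k\<in>{1..n}. \<exists>h. comm_assoc_alg scale h \<and> carrier h \<noteq> {0} \<and>
                       is_double_extension scale (As k) (As (k - 1)) h) \<and>
       As n = A)"
  \<comment> \<open>With chains of length zero allowed, the Milnor case and the inductive step are uniform.\<close>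
  have "\<exists>n As. chain A n As"
    using assms(2)
  proof (induction "dim (carrier A)" arbitrary: A rule: less_induct)
    case less
    interpret pre_symplectic_algebra scale A
      by unfold_locales fact
    show ?case
    proof (cases "milnor_pre_symplectic scale A")
      case True
      then have "chain A 0 (\<lambda>_. A)"
        using less.prems by (simp add: chain_def)
      then show ?thesis
        by blast
    next
      case False
      then obtain B h where B: "pre_symplectic_lsa scale B" "dim (carrier B) < dim (carrier A)"
        and h: "comm_assoc_alg scale h" "carrier h \<noteq> {0}" "is_double_extension scale A B h"
        by (rule double_extension_of_smaller)
      obtain n As where "chain B n As"
        using less.hyps[OF B(2,1)] by blast
      then have As: "\<And>k. k \<le> n \<Longrightarrow> pre_symplectic_lsa scale (As k)" "milnor_pre_symplectic scale (As 0)"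
        "\<And>k. k \<in> {1..n} \<Longrightarrow> \<exists>h. comm_assoc_alg scale h \<and> carrier h \<noteq> {0} \<and>
          is_double_extension scale (As k) (As (k - 1)) h" "As n = B"
        by (auto simp: chain_def)
      let ?As = "As(Suc n := A)"
      have "\<exists>h. comm_assoc_alg scale h \<and> carrier h \<noteq> {0} \<and>
          is_double_extension scale (?As k) (?As (k - 1)) h" if k: "k \<in> {1..Suc n}" for k
      proof (cases "k = Suc n")
        case True
        then show ?thesis
          using h As(4) by auto
      next
        case False
        then have "k \<in> {1..n}" "?As k = As k" "?As (k - 1) = As (k - 1)"
          using k by auto
        then show ?thesis
          using As(3)[of k] by simp
      qed
      then have "chain A (Suc n) ?As"
        using As(1,2) less.prems by (simp add: chain_def le_Suc_eq)
      then show ?thesis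
        by blast
    qed
  qed
  then obtain n As where chain: "chain A n As"
    by blast
  show ?thesis
  proof (cases "n = 0")
    case True
    then show ?thesis
      using chain by (auto simp: chain_def)
  next
    case False
    then show ?thesis
      using chain unfolding chain_def by (intro disjI2 exI[of _ n] exI[of _ As]) simp
  qed
qed

end
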